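(* Let $a,b>0$, $\gamma,\widetilde\gamma\in\mathbb{R}$, $\theta_2\in[-\pi,\pi]$, and put $\tau=\cos\theta_2$. Let $E\in(0,\infty)\setminus\sigma(\mathscr{H}_\gamma^{\theta_2})$ and $k=E^{1/2}$. Then $E\in\sigma_{\rm disc}(\mathscr{H}_{\gamma,\widetilde\gamma}^{\theta_2})$ if and only if $$ f_{\widetilde\gamma}^\tau(k)=\begin{cases} f_\gamma^\tau(k)+\sqrt{(f_\gamma^\tau(k))^2-1}, & \text{provided } f_\gamma^\tau(k)<-1,\\[2pt] f_\gamma^\tau(k)-\sqrt{(f_\gamma^\tau(k))^2-1}, & \text{provided } f_\gamma^\tau(k)>1.\end{cases} $$
   Context: Let $\Gamma_0$ be the infinite comb graph with vertices $x_j=(ja,0)$, $j\in\mathbb{Z}$, edges of length $a$ joining $x_{j-1}$ and $x_j$, and, for each $j$, two edges of length $b/2$ joining $x_j$ to $x_j^+=(ja,b/2)$ and to $x_j^-=(ja,-b/2)$. For $\gamma,\widetilde\gamma\in\mathbb{R}$ and $\theta_2\in[-\pi,\pi]$, $\mathscr{H}_{\gamma,\widetilde\gamma}^{\theta_2}$ is the self-adjoint operator in $L^2(\Gamma_0)$ acting as $-\frac{d^2}{dx^2}$ on each edge (functions in $H^2$ on each edge), with a $\delta$-coupling at each internal vertex $x_j$ (continuity of $\psi$ at $x_j$, and the sum of the derivatives of $\psi$ at $x_j$ taken in the outward directions of the edges emanating from $x_j$ equals $c_j\psi(x_j)$), where $c_0=\widetilde\gamma$ and $c_j=\gamma$ for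 $j\neq0$, and with the quasi-periodic conditions $\psi(x_j^+)=e^{i\theta_2}\psi(x_j^-)$, $\psi'(x_j^+)=e^{i\theta_2}\psi'(x_j^-)$ at the degree-one vertices (derivatives on the vertical edges taken with respect to the upward coordinate). Set $\mathscr{H}_\gamma^{\theta_2}:=\mathscr{H}_{\gamma,\gamma}^{\theta_2}$. Let $\Xi=\{k>0:\ \sin(ka)\sin(kb)=0\}$ and, for $\gamma\in\mathbb{R}$, $\tau\in[-1,1]$, define $f_\gamma^\tau:(0,\infty)\setminus\Xi\to\mathbb{R}$ by $$f_\gamma^\tau(k)=\frac{\gamma\sin ka}{2k}+\frac{\sin k(a+b)}{\sin kb}-\tau\frac{\sin ka}{\sin kb}.$$ For $E=k^2>0$ one has $E\in\sigma(\mathscr{H}_\gamma^{\theta_2})$ iff $|f_\gamma^{\cos\theta_2}(k)|\le1$; in particular $E\in(0,\infty)\setminus\sigma(\mathscr{H}_\gamma^{\theta_2})$ means $|f_\gamma^{\cos\theta_2}(k)|>1$. *)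

theory Defs
  imports "HOL-Analysis.Analysis"
begin

text \<open>Edges of the comb graph: for each j :: int there is the horizontal edge
 (Hor, j) of length a joining x_(j-1) (parameter 0) to x_j (parameter a), the upper
 vertical edge (Up, j) of length b/2 joining x_j (parameter 0) to x_j^+ (parameter b/2),
 and the lower vertical edge (Dn, j) of length b/2 joining x_j^- (parameter 0) to x_j
 (parameter b/2); vertical edges are parametrised by the upward coordinate.
 A function on the graph is psi :: int => etype => real => complex, psi j e restricted
 to [0, elen a b e].\<close>

datatype etype = Hor | Up | Dn

definition elen :: "real \<Rightarrow> real \<Rightarrow> etype \<Rightarrow> real" where
  "elen a b e = (case e of Hor \<Rightarrow> a | Up \<Rightarrow> b / 2 | Dn \<Rightarrow> b / 2)"

definition sqint :: "real \<Rightarrow> (real \<Rightarrow> complex) \<Rightarrow> bool" where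
  "sqint l u \<longleftrightarrow> set_borel_measurable lborel {0..l} u \<and>
     set_integrable lborel {0..l} (\<lambda>t. (cmod (u t))^2)"

text \<open>u belongs to H^2(0,l) and w is (a representative of) its second derivative:
 u is C^1 on [0,l] and u' is the indefinite Lebesgue integral of the L^2 function w.\<close>
definition H2sol :: "real \<Rightarrow> (real \<Rightarrow> complex) \<Rightarrow> (real \<Rightarrow> complex) \<Rightarrow> bool" where
  "H2sol l u w \<longleftrightarrow> sqint l w \<and>
     (\<exists>u'. (\<forall>t\<in>{0..l}. (u has_vector_derivative u' t) (at t within {0..l})) \<and>
           (\<forall>t\<in>{0..l}. u' t = u' 0 + (LINT s:{0..t}|lborel. w s)))"

definition edge_norm2 :: "real \<Rightarrow> (real \<Rightarrow> complex) \<Rightarrow> real" where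
  "edge_norm2 l u = (LINT t:{0..l}|lborel. (cmod (u t))^2)"

definition L2g :: "real \<Rightarrow> real \<Rightarrow> (int \<Rightarrow> etype \<Rightarrow> real \<Rightarrow> complex) \<Rightarrow> bool" where
  "L2g a b psi \<longleftrightarrow> (\<forall>j e. sqint (elen a b e) (psi j e)) \<and>
     (\<lambda>j. edge_norm2 a (psi j Hor) + edge_norm2 (b/2) (psi j Up) + edge_norm2 (b/2) (psi j Dn))
        summable_on (UNIV :: int set)"

definition dv :: "real \<Rightarrow> (real \<Rightarrow> complex) \<Rightarrow> real \<Rightarrow> complex" where
  "dv l u t = vector_derivative u (at t within {0..l})"

definition vertex_conds ::
  "real \<Rightarrow> real \<Rightarrow> (int \<Rightarrow> real) \<Rightarrow> real \<Rightarrow> (int \<Rightarrow> etype \<Rightarrow> real \<Rightarrow> complex) \<Rightarrow> bool" where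
  "vertex_conds a b c theta psi \<longleftrightarrow> (\<forall>j::int.
      psi j Hor a = psi (j+1) Hor 0 \<and> psi (j+1) Hor 0 = psi j Up 0 \<and> psi j Up 0 = psi j Dn (b/2) \<and>
      - dv a (psi j Hor) a + dv a (psi (j+1) Hor) 0 + dv (b/2) (psi j Up) 0 - dv (b/2) (psi j Dn) (b/2)
        = complex_of_real (c j) * psi j Up 0 \<and>
      psi j Up (b/2) = exp (\<i> * complex_of_real theta) * psi j Dn 0 \<and>
      dv (b/2) (psi j Up) (b/2) = exp (\<i> * complex_of_real theta) * dv (b/2) (psi j Dn) 0)"

text \<open>psi is in the operator domain and (H - E) psi = g (i.e. -psi'' = g + E psi on each edge)\<close>
definition solves ::
  "real \<Rightarrow> real \<Rightarrow> (int \<Rightarrow> real) \<Rightarrow> real \<Rightarrow> complex \<Rightarrow> (int \<Rightarrow> etype \<Rightarrow> real \<Rightarrow> complex)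
     \<Rightarrow> (int \<Rightarrow> etype \<Rightarrow> real \<Rightarrow> complex) \<Rightarrow> bool" where
  "solves a b c theta E psi g \<longleftrightarrow> L2g a b psi \<and>
     (\<forall>j e. H2sol (elen a b e) (psi j e) (\<lambda>t. - (g j e t + E * psi j e t))) \<and>
     vertex_conds a b c theta psi"

definition zero_on_edges :: "real \<Rightarrow> real \<Rightarrow> (int \<Rightarrow> etype \<Rightarrow> real \<Rightarrow> complex) \<Rightarrow> bool" where
  "zero_on_edges a b psi \<longleftrightarrow> (\<forall>j e. \<forall>t\<in>{0..elen a b e}. psi j e t = 0)"

text \<open>spectrum: E is in the resolvent set iff H - E is a bijection from the domain onto
 L^2 (for the closed operator H the inverse is then automatically bounded)\<close>
definition specH :: "real \<Rightarrow> real \<Rightarrow> (int \<Rightarrow> real) \<Rightarrow> real \<Rightarrow> complex set" where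
  "specH a b c theta = {E. \<not> ((\<forall>g. L2g a b g \<longrightarrow> (\<exists>psi. solves a b c theta E psi g)) \<and>
      (\<forall>psi. solves a b c theta E psi (\<lambda>_ _ _. 0) \<longrightarrow> zero_on_edges a b psi))}"

definition eigsp :: "real \<Rightarrow> real \<Rightarrow> (int \<Rightarrow> real) \<Rightarrow> real \<Rightarrow> complex
    \<Rightarrow> (int \<Rightarrow> etype \<Rightarrow> real \<Rightarrow> complex) set" where
  "eigsp a b c theta E = {psi. solves a b c theta E psi (\<lambda>_ _ _. 0)}"

definition disc_specH :: "real \<Rightarrow> real \<Rightarrow> (int \<Rightarrow> real) \<Rightarrow> real \<Rightarrow> complex set" where
  "disc_specH a b c theta = {E \<in> specH a b c theta.
     (\<exists>\<epsilon>>0. \<forall>\<mu>. \<mu> \<noteq> E \<and> cmod (\<mu> - E) < \<epsilon> \<longrightarrow> \<mu> \<notin> specH a b c theta) \<and>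
     (\<exists>psi\<in>eigsp a b c theta E. \<not> zero_on_edges a b psi) \<and>
     (\<exists>F. finite F \<and> F \<subseteq> eigsp a b c theta E \<and>
        (\<forall>psi\<in>eigsp a b c theta E. \<exists>co. \<forall>j e. \<forall>t\<in>{0..elen a b e}.
            psi j e t = (\<Sum>phi\<in>F. co phi * phi j e t)))}"

definition coup :: "real \<Rightarrow> real \<Rightarrow> int \<Rightarrow> real" where
  "coup \<gamma> \<gamma>t j = (if j = 0 then \<gamma>t else \<gamma>)"

definition specHg :: "real \<Rightarrow> real \<Rightarrow> real \<Rightarrow> real \<Rightarrow> real \<Rightarrow> complex set" where
  "specHg a b \<gamma> \<gamma>t theta = specH a b (coup \<gamma> \<gamma>t) theta"

definition disc_specHg :: "real \<Rightarrow> real \<Rightarrow> real \<Rightarrow> real \<Rightarrow> real \<Rightarrow> complex set" where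
  "disc_specHg a b \<gamma> \<gamma>t theta = disc_specH a b (coup \<gamma> \<gamma>t) theta"

definition Xi :: "real \<Rightarrow> real \<Rightarrow> real set" where
  "Xi a b = {k. k > 0 \<and> sin (k * a) * sin (k * b) = 0}"

definition ff :: "real \<Rightarrow> real \<Rightarrow> real \<Rightarrow> real \<Rightarrow> real \<Rightarrow> real" where
  "ff a b \<gamma> \<tau> k = \<gamma> * sin (k * a) / (2 * k) + sin (k * (a + b)) / sin (k * b)
      - \<tau> * sin (k * a) / sin (k * b)"

end

theory Submission
  imports Defs "HOL-Complex_Analysis.Complex_Analysis"
begin

text \<open>Fix \<open>E = \<kappa>\<^sup>2\<close>. On an edge every solution of \<open>- u'' = g + \<kappa>\<^sup>2 u\<close> is a particular solution
  plus a combination of \<open>cos \<kappa>t\<close> and \<open>sin \<kappa>t / \<kappa>\<close>. Eliminating the edges turns \<open>(H - \<kappa>\<^sup>2) \<psi> = g\<close>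
  into the recurrence \<open>y (j + 1) + y (j - 1) - 2 q\<^sub>j y j = h j\<close> for the vertex values
  \<open>y j = \<psi> (x\<^sub>j)\<close>, where \<open>q\<^sub>j\<close> is the discriminant \<open>f\<close> for the coupling at \<open>x\<^sub>j\<close>: \<open>q\<^sub>0 = G\<close> and
  \<open>q\<^sub>j = F\<close> for \<open>j \<noteq> 0\<close>. Let \<open>z + 1/z = 2 F\<close> with \<open>|z| \<le> 1\<close>. A square-summable solution of the
  homogeneous equations at all \<open>j \<noteq> 0\<close> is a multiple of \<open>z\<^bsup>|j|\<^esup>\<close>. If \<open>F \<in> [-1, 1]\<close>, then
  \<open>|z| = 1\<close>, only the zero sequence is left, a source acting at \<open>x\<^sub>0\<close> alone has no response, and
  \<open>\<kappa>\<^sup>2\<close> is in the spectrum. Otherwise \<open>|z| < 1\<close>, and \<open>z\<^bsup>|j|\<^esup>\<close> satisfies the equation at \<open>j = 0\<close>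
  exactly when \<open>G = z\<close>; if \<open>G \<noteq> z\<close>, the recurrence is uniquely solvable in \<open>\<ell>\<^sup>2\<close> and \<open>\<kappa>\<^sup>2\<close> is in
  the resolvent set. The equation \<open>G = z\<close> forces \<open>G\<^sup>2 - 2 F G + 1 = 0\<close>. The left-hand side is
  analytic in \<open>\<kappa>\<close> and does not vanish identically, since \<open>F\<close> and \<open>G\<close> are both asymptotic to
  \<open>2 sinh ta\<close> at \<open>\<kappa> = it\<close>; hence the eigenvalue is isolated.\<close>

subsection \<open>Square-integrable functions on an edge\<close>

lemma norm_add_square_le:
  fixes x y :: "'a::real_normed_vector"
  shows "(norm (x + y))\<^sup>2 \<le> 2 * ((norm x)\<^sup>2 + (norm y)\<^sup>2)"
proof -
  have "(norm (x + y))\<^sup>2 \<le> (norm x + norm y)\<^sup>2"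
    by (intro power_mono norm_triangle_ineq) auto
  also have "\<dots> \<le> 2 * ((norm x)\<^sup>2 + (norm y)\<^sup>2)"
    using sum_squares_ge_zero[of "norm x - norm y" 0] by (simp add: power2_eq_square algebra_simps)
  finally show ?thesis .
qed

lemma integrable_square_add:
  fixes f g :: "'a \<Rightarrow> 'b::{banach, second_countable_topology}"
  assumes [measurable]: "f \<in> borel_measurable M" "g \<in> borel_measurable M"
    and "integrable M (\<lambda>x. (norm (f x))\<^sup>2)" "integrable M (\<lambda>x. (norm (g x))\<^sup>2)"
  shows "integrable M (\<lambda>x. (norm (f x + g x))\<^sup>2)"
proof (rule Bochner_Integration.integrable_bound)
  show "integrable M (\<lambda>x. 2 * ((norm (f x))\<^sup>2 + (norm (g x))\<^sup>2))"
    using assms by simp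
  show "AE x in M. norm ((norm (f x + g x))\<^sup>2) \<le> norm (2 * ((norm (f x))\<^sup>2 + (norm (g x))\<^sup>2))"
    using norm_add_square_le[of "f _" "g _"] by (intro AE_I2) simp
qed measurable

lemma integrable_mult_of_squares:
  fixes f g :: "'a \<Rightarrow> 'b::{real_normed_field, banach, second_countable_topology}"
  assumes [measurable]: "f \<in> borel_measurable M" "g \<in> borel_measurable M"
    and "integrable M (\<lambda>x. (norm (f x))\<^sup>2)" "integrable M (\<lambda>x. (norm (g x))\<^sup>2)"
  shows "integrable M (\<lambda>x. f x * g x)"
proof (rule Bochner_Integration.integrable_bound)
  show "integrable M (\<lambda>x. (norm (f x))\<^sup>2 + (norm (g x))\<^sup>2)"
    using assms by simp
  have "p * q \<le> p\<^sup>2 + q\<^sup>2" if "0 \<le> p" "0 \<le> q" for p q :: real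
    using sum_squares_bound[of p q] mult_nonneg_nonneg[OF that] by linarith
  then show "AE x in M. norm (f x * g x) \<le> norm ((norm (f x))\<^sup>2 + (norm (g x))\<^sup>2)"
    by (intro AE_I2) (simp add: norm_mult)
qed measurable

lemma Cauchy_Schwarz_integral:
  fixes f g :: "'a \<Rightarrow> 'b::{real_normed_field, banach, second_countable_topology}"
  assumes [measurable]: "f \<in> borel_measurable M" "g \<in> borel_measurable M"
    and "integrable M (\<lambda>x. (norm (f x))\<^sup>2)" "integrable M (\<lambda>x. (norm (g x))\<^sup>2)"
  shows "norm (\<integral>x. f x * g x \<partial>M)
    \<le> sqrt (\<integral>x. (norm (f x))\<^sup>2 \<partial>M) * sqrt (\<integral>x. (norm (g x))\<^sup>2 \<partial>M)"
proof -
  have square: "(\<integral>\<^sup>+x. (ennreal (norm (h x)))\<^sup>2 \<partial>M) = ennreal (\<integral>x. (norm (h x))\<^sup>2 \<partial>M)"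
    if "integrable M (\<lambda>x. (norm (h x))\<^sup>2)" for h :: "'a \<Rightarrow> 'b"
    using nn_integral_eq_integral[OF that] by (simp add: ennreal_power)
  have "ennreal (norm (\<integral>x. f x * g x \<partial>M)) \<le> (\<integral>\<^sup>+x. ennreal (norm (f x)) * ennreal (norm (g x)) \<partial>M)"
    using integral_norm_bound_ennreal[OF integrable_mult_of_squares[OF assms]]
    by (simp add: norm_mult ennreal_mult)
  then have "(ennreal (norm (\<integral>x. f x * g x \<partial>M)))\<^sup>2
    \<le> (\<integral>\<^sup>+x. ennreal (norm (f x)) * ennreal (norm (g x)) \<partial>M)\<^sup>2"
    by (rule power_mono_ennreal)
  also have "\<dots> \<le> (\<integral>\<^sup>+x. (ennreal (norm (f x)))\<^sup>2 \<partial>M) * (\<integral>\<^sup>+x. (ennreal (norm (g x)))\<^sup>2 \<partial>M)"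
    by (rule Cauchy_Schwarz_nn_integral) measurable
  also have "\<dots> = ennreal ((\<integral>x. (norm (f x))\<^sup>2 \<partial>M) * (\<integral>x. (norm (g x))\<^sup>2 \<partial>M))"
    by (simp add: square assms ennreal_mult)
  finally have "(norm (\<integral>x. f x * g x \<partial>M))\<^sup>2 \<le> (\<integral>x. (norm (f x))\<^sup>2 \<partial>M) * (\<integral>x. (norm (g x))\<^sup>2 \<partial>M)"
    by (simp add: ennreal_power)
  then show ?thesis unfolding real_sqrt_mult[symmetric] by (rule real_le_rsqrt)
qed

definition cutoff :: "real \<Rightarrow> (real \<Rightarrow> complex) \<Rightarrow> real \<Rightarrow> complex" where
  "cutoff l u t = indicator {0..l} t *\<^sub>R u t"

lemma cutoff_add: "cutoff l (\<lambda>t. u t + v t) = (\<lambda>t. cutoff l u t + cutoff l v t)"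
  and cutoff_cmult: "cutoff l (\<lambda>t. c * u t) = (\<lambda>t. c * cutoff l u t)"
  and cutoff_mult: "cutoff l (\<lambda>t. u t * v t) = (\<lambda>t. cutoff l u t * cutoff l v t)"
  by (simp_all add: cutoff_def indicator_def fun_eq_iff)

lemma norm_cutoff_square: "(cmod (cutoff l u t))\<^sup>2 = indicator {0..l} t *\<^sub>R (cmod (u t))\<^sup>2"
  by (simp add: cutoff_def indicator_def)

lemma sqint_iff_cutoff:
  "sqint l u \<longleftrightarrow>
    cutoff l u \<in> borel_measurable lborel \<and> integrable lborel (\<lambda>t. (cmod (cutoff l u t))\<^sup>2)"
  unfolding sqint_def set_borel_measurable_def set_integrable_def norm_cutoff_square
  by (simp add: cutoff_def[abs_def])

lemma sqint_add: "sqint l u \<Longrightarrow> sqint l v \<Longrightarrow> sqint l (\<lambda>t. u t + v t)"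
  unfolding sqint_iff_cutoff cutoff_add
  by (intro conjI borel_measurable_add integrable_square_add) simp_all

lemma sqint_cmult: "sqint l u \<Longrightarrow> sqint l (\<lambda>t. c * u t)"
  unfolding sqint_iff_cutoff cutoff_cmult norm_mult power_mult_distrib
  by (intro conjI borel_measurable_times borel_measurable_const) simp_all

lemma sqint_uminus: "sqint l u \<Longrightarrow> sqint l (\<lambda>t. - u t)"
  using sqint_cmult[of l u "-1"] by simp

lemma sqint_continuous:
  assumes "continuous_on {0..l} u"
  shows "sqint l u"
proof -
  have "continuous_on {0..l} (\<lambda>t. (cmod (u t))\<^sup>2)" by (intro continuous_intros assms)
  from borel_integrable_atLeastAtMost'[OF this] show ?thesis
    using borel_integrable_atLeastAtMost'[OF assms]
    by (auto simp: sqint_def set_borel_measurable_def set_integrable_def)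
qed

lemma sqint_set_integrable_mult:
  assumes "sqint l u" "sqint l v"
  shows "set_integrable lborel {0..l} (\<lambda>t. u t * v t)"
proof -
  have "integrable lborel (cutoff l (\<lambda>t. u t * v t))"
    unfolding cutoff_mult using assms
    by (intro integrable_mult_of_squares) (simp_all add: sqint_iff_cutoff)
  then show ?thesis by (simp add: set_integrable_def cutoff_def[abs_def])
qed

lemma sqint_set_integrable: "sqint l u \<Longrightarrow> set_integrable lborel {0..l} u"
  using sqint_set_integrable_mult[OF _ sqint_continuous[of l "\<lambda>_. 1"]] by simp

lemma sqint_integrable_on: "sqint l u \<Longrightarrow> u integrable_on {0..l}"
  by (rule set_borel_integral_eq_integral(1)[OF sqint_set_integrable])

definition edge_norm :: "real \<Rightarrow> (real \<Rightarrow> complex) \<Rightarrow> real" where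
  "edge_norm l u = sqrt (edge_norm2 l u)"

lemma edge_norm2_eq_cutoff: "edge_norm2 l u = (\<integral>t. (cmod (cutoff l u t))\<^sup>2 \<partial>lborel)"
  unfolding edge_norm2_def set_lebesgue_integral_def norm_cutoff_square ..

lemma edge_norm2_nonneg: "0 \<le> edge_norm2 l u"
  by (simp add: edge_norm2_eq_cutoff)

lemma edge_norm_nonneg: "0 \<le> edge_norm l u"
  by (simp add: edge_norm_def edge_norm2_nonneg)

lemma edge_norm_square: "(edge_norm l u)\<^sup>2 = edge_norm2 l u"
  by (simp add: edge_norm_def edge_norm2_nonneg)

lemma edge_norm_zero: "edge_norm l (\<lambda>_. 0) = 0"
  and edge_norm_one: "l \<ge> 0 \<Longrightarrow> edge_norm l (\<lambda>_. 1) = sqrt l"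
  by (simp_all add: edge_norm_def edge_norm2_def set_lebesgue_integral_def)

lemma sqint_subinterval:
  assumes "sqint l u" "t \<in> {0..l}"
  shows "sqint t u" and "edge_norm t u \<le> edge_norm l u"
proof -
  have [measurable]: "cutoff l u \<in> borel_measurable lborel"
    and integrable_l: "integrable lborel (\<lambda>s. (cmod (cutoff l u s))\<^sup>2)"
    using assms(1) by (simp_all add: sqint_iff_cutoff)
  have cutoff: "cutoff t u = (\<lambda>s. indicator {0..t} s *\<^sub>R cutoff l u s)"
    using assms(2) by (auto simp: cutoff_def indicator_def)
  have meas: "cutoff t u \<in> borel_measurable lborel" unfolding cutoff by measurable
  have cutoff_le: "(cmod (cutoff t u s))\<^sup>2 \<le> (cmod (cutoff l u s))\<^sup>2" for s
    by (simp add: cutoff indicator_def)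
  have integrable_t: "integrable lborel (\<lambda>s. (cmod (cutoff t u s))\<^sup>2)"
    by (rule Bochner_Integration.integrable_bound[OF integrable_l]) (use meas cutoff_le in auto)
  show "sqint t u" using meas integrable_t by (simp add: sqint_iff_cutoff)
  show "edge_norm t u \<le> edge_norm l u"
    unfolding edge_norm_def edge_norm2_eq_cutoff
    by (intro real_sqrt_le_mono integral_mono[OF integrable_t integrable_l cutoff_le])
qed

lemma edge_norm_le:
  assumes "sqint l u" "l \<ge> 0" "\<And>t. t \<in> {0..l} \<Longrightarrow> cmod (u t) \<le> B"
  shows "edge_norm l u \<le> sqrt l * B"
proof -
  have "B \<ge> 0" using assms(2) norm_ge_zero order_trans[OF _ assms(3)[of 0]] by auto
  have "edge_norm2 l u \<le> (LINT t:{0..l}|lborel. B\<^sup>2)"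
    unfolding edge_norm2_def
  proof (rule set_integral_mono)
    show "set_integrable lborel {0..l} (\<lambda>t. (cmod (u t))\<^sup>2)" using assms(1) by (simp add: sqint_def)
    show "set_integrable lborel {0..l} (\<lambda>t. B\<^sup>2)" by (rule borel_integrable_atLeastAtMost') simp
    show "(cmod (u t))\<^sup>2 \<le> B\<^sup>2" if "t \<in> {0..l}" for t
      using assms(3)[OF that] by (simp add: power_mono)
  qed
  also have "\<dots> = l * B\<^sup>2" using assms(2) by (simp add: set_lebesgue_integral_def)
  finally show ?thesis
    unfolding edge_norm_def using \<open>B \<ge> 0\<close> real_sqrt_le_mono[of _ "l * B\<^sup>2"]
    by (simp add: real_sqrt_mult)
qed

definition primitive :: "(real \<Rightarrow> complex) \<Rightarrow> real \<Rightarrow> complex" where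
  "primitive g t = integral {0..t} g"

lemma primitive_0 [simp]: "primitive g 0 = 0"
  and primitive_zero [simp]: "primitive (\<lambda>_. 0) t = 0"
  by (simp_all add: primitive_def)

lemma primitive_cmult: "primitive (\<lambda>s. c * g s) t = c * primitive g t"
  and primitive_uminus: "primitive (\<lambda>s. - g s) t = - primitive g t"
  by (simp_all add: primitive_def)

lemma primitive_add:
  assumes "sqint l f" "sqint l g" "t \<in> {0..l}"
  shows "primitive (\<lambda>s. f s + g s) t = primitive f t + primitive g t"
  unfolding primitive_def
  by (intro Henstock_Kurzweil_Integration.integral_add sqint_integrable_on
      sqint_subinterval(1)[OF _ assms(3)] assms(1,2))

lemma set_lebesgue_integral_eq_primitive:
  assumes "sqint l g" "t \<in> {0..l}"
  shows "(LINT s:{0..t}|lborel. g s) = primitive g t"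
  unfolding primitive_def
  by (intro set_borel_integral_eq_integral(2) sqint_set_integrable sqint_subinterval(1)[OF assms])

lemma continuous_on_primitive: "sqint l g \<Longrightarrow> continuous_on {0..l} (primitive g)"
  unfolding primitive_def[abs_def] by (intro indefinite_integral_continuous_1 sqint_integrable_on)

lemma primitive_has_vector_derivative:
  "continuous_on {0..l} g \<Longrightarrow> t \<in> {0..l} \<Longrightarrow>
    (primitive g has_vector_derivative g t) (at t within {0..l})"
  unfolding primitive_def[abs_def] by (rule integral_has_vector_derivative)

lemma primitive_derivative:
  assumes "\<And>s. s \<in> {0..l} \<Longrightarrow> (u has_vector_derivative u' s) (at s within {0..l})" "t \<in> {0..l}"
  shows "primitive u' t = u t - u 0"
  unfolding primitive_def
proof (rule integral_unique, rule fundamental_theorem_of_calculus)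
  show "(u has_vector_derivative u' s) (at s within {0..t})" if "s \<in> {0..t}" for s
    by (rule has_vector_derivative_within_subset[OF assms(1)]) (use assms(2) that in auto)
qed (use assms(2) in auto)

lemma norm_primitive_mult_le:
  assumes "sqint l u" "sqint l v" "t \<in> {0..l}"
  shows "cmod (primitive (\<lambda>s. u s * v s) t) \<le> edge_norm l u * edge_norm l v"
proof -
  note u = sqint_subinterval[OF assms(1,3)] and v = sqint_subinterval[OF assms(2,3)]
  have "primitive (\<lambda>s. u s * v s) t = (LINT s:{0..t}|lborel. u s * v s)"
    unfolding primitive_def
    by (intro set_borel_integral_eq_integral(2)[symmetric] sqint_set_integrable_mult u(1) v(1))
  also have "\<dots> = (\<integral>s. cutoff t u s * cutoff t v s \<partial>lborel)"
    unfolding set_lebesgue_integral_def cutoff_mult[THEN fun_cong, symmetric]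
    by (simp add: cutoff_def)
  finally have "cmod (primitive (\<lambda>s. u s * v s) t) \<le> edge_norm t u * edge_norm t v"
    unfolding edge_norm_def edge_norm2_eq_cutoff
    using u(1) v(1) by (simp add: sqint_iff_cutoff Cauchy_Schwarz_integral)
  also have "\<dots> \<le> edge_norm l u * edge_norm l v"
    by (intro mult_mono u v edge_norm_nonneg)
  finally show ?thesis .
qed

lemma norm_primitive_le:
  assumes "sqint l g" "t \<in> {0..l}"
  shows "cmod (primitive g t) \<le> sqrt l * edge_norm l g"
  using norm_primitive_mult_le[OF sqint_continuous[of l "\<lambda>_. 1"] assms] assms(2)
  by (simp add: edge_norm_one)

lemma norm_primitive_mult_primitive_le:
  assumes "sqint l f" "sqint l g" "t \<in> {0..l}"
  shows "cmod (primitive (\<lambda>s. f s * primitive g s) t) \<le> edge_norm l f * (l * edge_norm l g)"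
proof -
  have sqint: "sqint l (primitive g)"
    by (rule sqint_continuous[OF continuous_on_primitive[OF assms(2)]])
  have "edge_norm l (primitive g) \<le> sqrt l * (sqrt l * edge_norm l g)"
    by (rule edge_norm_le[OF sqint _ norm_primitive_le[OF assms(2)]]) (use assms(3) in auto)
  also have "\<dots> = l * edge_norm l g" using assms(3) by (simp flip: mult.assoc)
  finally show ?thesis
    using norm_primitive_mult_le[OF assms(1) sqint assms(3)] edge_norm_nonneg[of l f]
    by (meson mult_left_mono order_trans)
qed

subsection \<open>The equation on a single edge\<close>

definition cs :: "complex \<Rightarrow> real \<Rightarrow> complex" where
  "cs \<kappa> t = cos (\<kappa> * of_real t)"

text \<open>Division by zero makes \<open>sn 0 t = 0\<close>, so that \<open>sn \<kappa> t \<noteq> 0\<close> entails \<open>\<kappa> \<noteq> 0\<close>.\<close>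

definition sn :: "complex \<Rightarrow> real \<Rightarrow> complex" where
  "sn \<kappa> t = sin (\<kappa> * of_real t) / \<kappa>"

lemma cs_0 [simp]: "cs \<kappa> 0 = 1" and sn_0 [simp]: "sn \<kappa> 0 = 0"
  by (simp_all add: cs_def sn_def)

lemma cs_has_vector_derivative:
  assumes "\<kappa> \<noteq> 0"
  shows "(cs \<kappa> has_vector_derivative - (\<kappa>\<^sup>2 * sn \<kappa> t)) (at t within S)"
proof -
  have "((\<lambda>z. cos (\<kappa> * z)) has_field_derivative - sin (\<kappa> * of_real t) * \<kappa>) (at (of_real t))"
    by (auto intro!: derivative_eq_intros)
  from has_vector_derivative_real_field[OF this, of S] show ?thesis
    using assms by (simp add: cs_def[abs_def] sn_def power2_eq_square mult.commute)
qed

lemma sn_has_vector_derivative: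
  assumes "\<kappa> \<noteq> 0"
  shows "(sn \<kappa> has_vector_derivative cs \<kappa> t) (at t within S)"
proof -
  have "((\<lambda>z. sin (\<kappa> * z) / \<kappa>) has_field_derivative cos (\<kappa> * of_real t)) (at (of_real t))"
    using assms by (auto intro!: derivative_eq_intros)
  from has_vector_derivative_real_field[OF this, of S] show ?thesis
    by (simp add: cs_def sn_def[abs_def])
qed

lemma continuous_on_cs: "continuous_on S (cs \<kappa>)" and continuous_on_sn: "continuous_on S (sn \<kappa>)"
  unfolding cs_def[abs_def] sn_def[abs_def] divide_inverse by (intro continuous_intros)+

lemma cs_square_add_sn_square: "\<kappa> \<noteq> 0 \<Longrightarrow> (cs \<kappa> t)\<^sup>2 + \<kappa>\<^sup>2 * (sn \<kappa> t)\<^sup>2 = 1"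
  by (simp add: cs_def sn_def power_divide)

lemma cs_add: "\<kappa> \<noteq> 0 \<Longrightarrow> cs \<kappa> (s + t) = cs \<kappa> s * cs \<kappa> t - \<kappa>\<^sup>2 * sn \<kappa> s * sn \<kappa> t"
  and sn_add: "sn \<kappa> (s + t) = sn \<kappa> s * cs \<kappa> t + cs \<kappa> s * sn \<kappa> t"
  by (simp_all add: cs_def sn_def distrib_left cos_add sin_add power2_eq_square add_divide_distrib)

definition dirichlet_slope :: "complex \<Rightarrow> real \<Rightarrow> complex \<Rightarrow> complex \<Rightarrow> complex" where
  "dirichlet_slope \<kappa> l x y = (y - x * cs \<kappa> l) / sn \<kappa> l"

lemma dirichlet_slope_iff:
  "sn \<kappa> l \<noteq> 0 \<Longrightarrow> x * cs \<kappa> l + \<beta> * sn \<kappa> l = y \<longleftrightarrow> \<beta> = dirichlet_slope \<kappa> l x y"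
  by (auto simp: dirichlet_slope_def field_simps)

lemma dirichlet_end_slope:
  assumes "\<kappa> \<noteq> 0" "sn \<kappa> l \<noteq> 0"
  shows "dirichlet_slope \<kappa> l x y * cs \<kappa> l - \<kappa>\<^sup>2 * x * sn \<kappa> l = - dirichlet_slope \<kappa> l y x"
proof -
  have "dirichlet_slope \<kappa> l x y * cs \<kappa> l - \<kappa>\<^sup>2 * x * sn \<kappa> l
    = (y * cs \<kappa> l - x * ((cs \<kappa> l)\<^sup>2 + \<kappa>\<^sup>2 * (sn \<kappa> l)\<^sup>2)) / sn \<kappa> l"
    using assms(2) by (simp add: dirichlet_slope_def field_simps power2_eq_square)
  also have "\<dots> = - dirichlet_slope \<kappa> l y x"
    unfolding cs_square_add_sn_square[OF assms(1)]
    by (simp add: dirichlet_slope_def diff_divide_distrib)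
  finally show ?thesis .
qed

lemma dv_eq:
  assumes "(u has_vector_derivative d) (at t within {0..l})" "t \<in> {0..l}" "l > 0"
  shows "dv l u t = d"
  unfolding dv_def by (rule vector_derivative_within_closed_interval) (use assms in auto)

lemma dv_cong:
  assumes "\<And>s. s \<in> {0..l} \<Longrightarrow> u s = v s" "t \<in> {0..l}"
  shows "dv l u t = dv l v t"
  unfolding dv_def by (rule vector_derivative_cong_eq) (use assms in auto)

lemma H2sol_iff_primitive:
  assumes "sqint l w"
  shows "H2sol l u w \<longleftrightarrow>
    (\<exists>u'. (\<forall>t\<in>{0..l}. (u has_vector_derivative u' t) (at t within {0..l})) \<and>
          (\<forall>t\<in>{0..l}. u' t = u' 0 + primitive w t))"
  unfolding H2sol_def using assms by (simp add: set_lebesgue_integral_eq_primitive)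

lemma H2sol_of_C2:
  assumes "\<And>t. t \<in> {0..l} \<Longrightarrow> (u has_vector_derivative u' t) (at t within {0..l})"
    and "\<And>t. t \<in> {0..l} \<Longrightarrow> (u' has_vector_derivative u'' t) (at t within {0..l})"
    and "continuous_on {0..l} u''"
  shows "H2sol l u u''"
  unfolding H2sol_iff_primitive[OF sqint_continuous[OF assms(3)]]
  using assms(1) primitive_derivative[OF assms(2)] by (intro exI[of _ u']) simp

text \<open>For merely integrable \<open>g\<close> the equation \<open>- u'' = g + E u\<close> holds only almost everywhere, but the
  shifted slope \<open>v = u' + \<integral>g\<close> is \<open>C\<^sup>1\<close>.\<close>

definition edge_system ::
  "real \<Rightarrow> complex \<Rightarrow> (real \<Rightarrow> complex) \<Rightarrow> (real \<Rightarrow> complex) \<Rightarrow> (real \<Rightarrow> complex) \<Rightarrow> bool" where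
  "edge_system l E g u v \<longleftrightarrow>
     (\<forall>t\<in>{0..l}. (u has_vector_derivative v t - primitive g t) (at t within {0..l}) \<and>
                 (v has_vector_derivative - (E * u t)) (at t within {0..l}))"

lemma edge_systemD:
  assumes "edge_system l E g u v" "t \<in> {0..l}"
  shows "(u has_vector_derivative v t - primitive g t) (at t within {0..l})"
    and "(v has_vector_derivative - (E * u t)) (at t within {0..l})"
  using assms by (auto simp: edge_system_def)

lemma continuous_on_edge_system: "edge_system l E g u v \<Longrightarrow> continuous_on {0..l} u"
  by (rule continuous_on_vector_derivative[OF edge_systemD(1)])

lemma
  assumes g: "sqint l g" and u: "continuous_on {0..l} u"
  shows sqint_edge_rhs: "sqint l (\<lambda>t. - (g t + E * u t))"
    and primitive_edge_rhs: "t \<in> {0..l} \<Longrightarrow>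
      primitive (\<lambda>t. - (g t + E * u t)) t = primitive (\<lambda>t. - (E * u t)) t - primitive g t"
proof -
  show sqint: "sqint l (\<lambda>t. - (g t + E * u t))"
    by (intro sqint_uminus sqint_add sqint_cmult g sqint_continuous u)
  show "primitive (\<lambda>t. - (g t + E * u t)) t = primitive (\<lambda>t. - (E * u t)) t - primitive g t"
    if "t \<in> {0..l}"
    using primitive_add[OF sqint g that] by simp
qed

lemma H2sol_imp_edge_system:
  assumes g: "sqint l g" and H2: "H2sol l u (\<lambda>t. - (g t + E * u t))"
  obtains v where "edge_system l E g u v"
proof -
  let ?w = "\<lambda>t. - (g t + E * u t)"
  obtain u' where
    u: "\<And>t. t \<in> {0..l} \<Longrightarrow> (u has_vector_derivative u' t) (at t within {0..l})" and
    u': "\<And>t. t \<in> {0..l} \<Longrightarrow> u' t = u' 0 + primitive ?w t"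
    using H2 H2sol_iff_primitive[of l ?w u] unfolding H2sol_def by blast
  have cont: "continuous_on {0..l} u" by (rule continuous_on_vector_derivative[OF u])
  define v where "v t = u' 0 + primitive (\<lambda>s. - (E * u s)) t" for t
  have "edge_system l E g u v"
    unfolding edge_system_def
  proof (intro ballI conjI)
    fix t assume t: "t \<in> {0..l}"
    show "(u has_vector_derivative v t - primitive g t) (at t within {0..l})"
      using u[OF t] u'[OF t] primitive_edge_rhs[OF g cont t, of E] by (simp add: v_def add_diff_eq)
    have "(primitive (\<lambda>s. - (E * u s)) has_vector_derivative - (E * u t)) (at t within {0..l})"
      by (intro primitive_has_vector_derivative t continuous_intros cont)
    from has_vector_derivative_add[OF has_vector_derivative_const this, of "u' 0"]
    show "(v has_vector_derivative - (E * u t)) (at t within {0..l})"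
      by (simp add: v_def[abs_def])
  qed
  then show thesis by (rule that)
qed

lemma edge_system_imp_H2sol:
  assumes g: "sqint l g" and sys: "edge_system l E g u v"
  shows "H2sol l u (\<lambda>t. - (g t + E * u t))"
proof -
  note cont = continuous_on_edge_system[OF sys]
  show ?thesis
    unfolding H2sol_iff_primitive[OF sqint_edge_rhs[OF g cont]]
  proof (intro conjI exI[of _ "\<lambda>t. v t - primitive g t"] ballI edge_systemD(1)[OF sys])
    fix t assume t: "t \<in> {0..l}"
    show "v t - primitive g t = v 0 - primitive g 0 + primitive (\<lambda>t. - (g t + E * u t)) t"
      using primitive_edge_rhs[OF g cont t] primitive_derivative[OF edge_systemD(2)[OF sys] t]
      by simp
  qed
qed

text \<open>Variation of constants for \<open>edge_system\<close>, with \<open>edge_slope\<close> in the role of \<open>u'\<close>, not \<open>v\<close>.\<close>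

definition cs_coeff :: "complex \<Rightarrow> (real \<Rightarrow> complex) \<Rightarrow> complex \<Rightarrow> real \<Rightarrow> complex" where
  "cs_coeff \<kappa> g \<alpha> t = \<alpha> - primitive (\<lambda>s. cs \<kappa> s * primitive g s) t"

definition sn_coeff :: "complex \<Rightarrow> (real \<Rightarrow> complex) \<Rightarrow> complex \<Rightarrow> real \<Rightarrow> complex" where
  "sn_coeff \<kappa> g \<beta> t = \<beta> - \<kappa>\<^sup>2 * primitive (\<lambda>s. sn \<kappa> s * primitive g s) t"

definition edge_sol :: "complex \<Rightarrow> (real \<Rightarrow> complex) \<Rightarrow> complex \<Rightarrow> complex \<Rightarrow> real \<Rightarrow> complex" where
  "edge_sol \<kappa> g \<alpha> \<beta> t = cs_coeff \<kappa> g \<alpha> t * cs \<kappa> t + sn_coeff \<kappa> g \<beta> t * sn \<kappa> t"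

definition edge_slope :: "complex \<Rightarrow> (real \<Rightarrow> complex) \<Rightarrow> complex \<Rightarrow> complex \<Rightarrow> real \<Rightarrow> complex" where
  "edge_slope \<kappa> g \<alpha> \<beta> t =
     sn_coeff \<kappa> g \<beta> t * cs \<kappa> t - \<kappa>\<^sup>2 * cs_coeff \<kappa> g \<alpha> t * sn \<kappa> t - primitive g t"

lemma edge_sol_0 [simp]: "edge_sol \<kappa> g \<alpha> \<beta> 0 = \<alpha>"
  and edge_slope_0 [simp]: "edge_slope \<kappa> g \<alpha> \<beta> 0 = \<beta>"
  by (simp_all add: edge_sol_def edge_slope_def cs_coeff_def sn_coeff_def)

lemma edge_sol_no_source: "edge_sol \<kappa> (\<lambda>_. 0) \<alpha> \<beta> t = \<alpha> * cs \<kappa> t + \<beta> * sn \<kappa> t"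
  and edge_slope_no_source: "edge_slope \<kappa> (\<lambda>_. 0) \<alpha> \<beta> t = \<beta> * cs \<kappa> t - \<kappa>\<^sup>2 * \<alpha> * sn \<kappa> t"
  by (simp_all add: edge_sol_def edge_slope_def cs_coeff_def sn_coeff_def)

lemma edge_sol_affine:
  "edge_sol \<kappa> g (\<alpha> + \<alpha>') (\<beta> + \<beta>') t = edge_sol \<kappa> g \<alpha> \<beta> t + (\<alpha>' * cs \<kappa> t + \<beta>' * sn \<kappa> t)"
  and edge_slope_affine:
  "edge_slope \<kappa> g (\<alpha> + \<alpha>') (\<beta> + \<beta>') t
    = edge_slope \<kappa> g \<alpha> \<beta> t + (\<beta>' * cs \<kappa> t - \<kappa>\<^sup>2 * \<alpha>' * sn \<kappa> t)"
  by (simp_all add: edge_sol_def edge_slope_def cs_coeff_def sn_coeff_def algebra_simps)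

lemmas edge_sol_split = edge_sol_affine[of _ _ 0 _ 0, unfolded add_0_left]
  and edge_slope_split = edge_slope_affine[of _ _ 0 _ 0, unfolded add_0_left]

lemma
  assumes "\<kappa> \<noteq> 0"
  shows edge_sol_concat:
    "edge_sol \<kappa> g (edge_sol \<kappa> h \<alpha> \<beta> s / w) (edge_slope \<kappa> h \<alpha> \<beta> s / w) t
      = edge_sol \<kappa> g (edge_sol \<kappa> h 0 0 s / w) (edge_slope \<kappa> h 0 0 s / w) t
        + (\<alpha> * cs \<kappa> (s + t) + \<beta> * sn \<kappa> (s + t)) / w"
    and edge_slope_concat:
    "edge_slope \<kappa> g (edge_sol \<kappa> h \<alpha> \<beta> s / w) (edge_slope \<kappa> h \<alpha> \<beta> s / w) t
      = edge_slope \<kappa> g (edge_sol \<kappa> h 0 0 s / w) (edge_slope \<kappa> h 0 0 s / w) t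
        + (\<beta> * cs \<kappa> (s + t) - \<kappa>\<^sup>2 * \<alpha> * sn \<kappa> (s + t)) / w"
  unfolding edge_sol_split[of \<kappa> h \<alpha> \<beta>] edge_slope_split[of \<kappa> h \<alpha> \<beta>] add_divide_distrib
    edge_sol_affine edge_slope_affine cs_add[OF assms] sn_add
  by (simp_all add: field_simps power2_eq_square add_divide_distrib diff_divide_distrib)

lemma
  assumes "sqint l g" "t \<in> {0..l}"
  shows cs_coeff_has_vector_derivative:
      "(cs_coeff \<kappa> g \<alpha> has_vector_derivative - (cs \<kappa> t * primitive g t)) (at t within {0..l})"
    and sn_coeff_has_vector_derivative:
      "(sn_coeff \<kappa> g \<beta> has_vector_derivative - (\<kappa>\<^sup>2 * (sn \<kappa> t * primitive g t)))
        (at t within {0..l})"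
proof -
  note cont = continuous_on_mult[OF _ continuous_on_primitive[OF assms(1)]]
  have "(cs_coeff \<kappa> g \<alpha> has_vector_derivative 0 - cs \<kappa> t * primitive g t) (at t within {0..l})"
    "(sn_coeff \<kappa> g \<beta> has_vector_derivative 0 - \<kappa>\<^sup>2 * (sn \<kappa> t * primitive g t)) (at t within {0..l})"
    unfolding cs_coeff_def[abs_def] sn_coeff_def[abs_def]
    by (intro has_vector_derivative_diff has_vector_derivative_const
        has_vector_derivative_mult_right primitive_has_vector_derivative
        cont continuous_on_cs continuous_on_sn assms(2))+
  then show "(cs_coeff \<kappa> g \<alpha> has_vector_derivative - (cs \<kappa> t * primitive g t)) (at t within {0..l})"
    "(sn_coeff \<kappa> g \<beta> has_vector_derivative - (\<kappa>\<^sup>2 * (sn \<kappa> t * primitive g t))) (at t within {0..l})"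
    by simp_all
qed

lemma edge_system_edge_sol:
  assumes "\<kappa> \<noteq> 0" "sqint l g"
  shows "edge_system l (\<kappa>\<^sup>2) g (edge_sol \<kappa> g \<alpha> \<beta>) (\<lambda>t. edge_slope \<kappa> g \<alpha> \<beta> t + primitive g t)"
  unfolding edge_system_def
proof (intro ballI conjI)
  fix t assume t: "t \<in> {0..l}"
  note coeffs = cs_coeff_has_vector_derivative[OF assms(2) t]
      sn_coeff_has_vector_derivative[OF assms(2) t]
    and cs = cs_has_vector_derivative[OF assms(1)] and sn = sn_has_vector_derivative[OF assms(1)]
  let ?A = "cs_coeff \<kappa> g \<alpha> t" and ?B = "sn_coeff \<kappa> g \<beta> t" and ?G = "primitive g t"
  have "(edge_sol \<kappa> g \<alpha> \<beta> has_vector_derivative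
      (?A * - (\<kappa>\<^sup>2 * sn \<kappa> t) + - (cs \<kappa> t * ?G) * cs \<kappa> t)
      + (?B * cs \<kappa> t + - (\<kappa>\<^sup>2 * (sn \<kappa> t * ?G)) * sn \<kappa> t)) (at t within {0..l})"
    unfolding edge_sol_def[abs_def]
    by (intro has_vector_derivative_add has_vector_derivative_mult coeffs cs sn)
  moreover have "(?A * - (\<kappa>\<^sup>2 * sn \<kappa> t) + - (cs \<kappa> t * ?G) * cs \<kappa> t)
      + (?B * cs \<kappa> t + - (\<kappa>\<^sup>2 * (sn \<kappa> t * ?G)) * sn \<kappa> t)
    = ?B * cs \<kappa> t - \<kappa>\<^sup>2 * ?A * sn \<kappa> t - ((cs \<kappa> t)\<^sup>2 + \<kappa>\<^sup>2 * (sn \<kappa> t)\<^sup>2) * ?G"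
    by (simp add: algebra_simps power2_eq_square)
  ultimately show "(edge_sol \<kappa> g \<alpha> \<beta> has_vector_derivative
      edge_slope \<kappa> g \<alpha> \<beta> t + ?G - ?G) (at t within {0..l})"
    by (simp only: edge_slope_def cs_square_add_sn_square[OF assms(1)] mult_1_left add_diff_cancel)
  have "((\<lambda>t. sn_coeff \<kappa> g \<beta> t * cs \<kappa> t - \<kappa>\<^sup>2 * (cs_coeff \<kappa> g \<alpha> t * sn \<kappa> t)) has_vector_derivative
      (?B * - (\<kappa>\<^sup>2 * sn \<kappa> t) + - (\<kappa>\<^sup>2 * (sn \<kappa> t * ?G)) * cs \<kappa> t)
      - \<kappa>\<^sup>2 * (?A * cs \<kappa> t + - (cs \<kappa> t * ?G) * sn \<kappa> t)) (at t within {0..l})"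
    by (intro has_vector_derivative_diff has_vector_derivative_mult has_vector_derivative_mult_right
        coeffs cs sn)
  moreover have "(?B * - (\<kappa>\<^sup>2 * sn \<kappa> t) + - (\<kappa>\<^sup>2 * (sn \<kappa> t * ?G)) * cs \<kappa> t)
      - \<kappa>\<^sup>2 * (?A * cs \<kappa> t + - (cs \<kappa> t * ?G) * sn \<kappa> t) = - (\<kappa>\<^sup>2 * edge_sol \<kappa> g \<alpha> \<beta> t)"
    by (simp add: edge_sol_def algebra_simps)
  ultimately show "((\<lambda>t. edge_slope \<kappa> g \<alpha> \<beta> t + primitive g t) has_vector_derivative
      - (\<kappa>\<^sup>2 * edge_sol \<kappa> g \<alpha> \<beta> t)) (at t within {0..l})"
    by (simp add: edge_slope_def mult.assoc)
qed

lemma H2sol_edge_sol: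
  "\<kappa> \<noteq> 0 \<Longrightarrow> sqint l g \<Longrightarrow> H2sol l (edge_sol \<kappa> g \<alpha> \<beta>) (\<lambda>t. - (g t + \<kappa>\<^sup>2 * edge_sol \<kappa> g \<alpha> \<beta> t))"
  using edge_system_imp_H2sol edge_system_edge_sol by blast

lemma continuous_on_edge_sol: "\<kappa> \<noteq> 0 \<Longrightarrow> sqint l g \<Longrightarrow> continuous_on {0..l} (edge_sol \<kappa> g \<alpha> \<beta>)"
  by (rule continuous_on_edge_system[OF edge_system_edge_sol])

lemma dv_edge_sol:
  assumes "\<kappa> \<noteq> 0" "sqint l g" "t \<in> {0..l}" "l > 0"
  shows "dv l (edge_sol \<kappa> g \<alpha> \<beta>) t = edge_slope \<kappa> g \<alpha> \<beta> t"
  using dv_eq[OF edge_systemD(1)[OF edge_system_edge_sol[OF assms(1,2)] assms(3)] assms(3,4)]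
  by simp

lemma edge_system_coeffs:
  assumes "\<kappa> \<noteq> 0" and sys: "edge_system l (\<kappa>\<^sup>2) g u v" and t: "t \<in> {0..l}"
  shows "u t * cs \<kappa> t - v t * sn \<kappa> t = cs_coeff \<kappa> g (u 0) t"
    and "\<kappa>\<^sup>2 * (u t * sn \<kappa> t) + v t * cs \<kappa> t = sn_coeff \<kappa> g (v 0) t"
proof -
  note derivs = edge_systemD[OF sys]
    cs_has_vector_derivative[OF assms(1)] sn_has_vector_derivative[OF assms(1)]
  have "((\<lambda>t. u t * cs \<kappa> t - v t * sn \<kappa> t) has_vector_derivative - (cs \<kappa> t * primitive g t))
      (at t within {0..l})" if t: "t \<in> {0..l}" for t
  proof -
    have "((\<lambda>t. u t * cs \<kappa> t - v t * sn \<kappa> t) has_vector_derivative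
      (u t * - (\<kappa>\<^sup>2 * sn \<kappa> t) + (v t - primitive g t) * cs \<kappa> t)
        - (v t * cs \<kappa> t + - (\<kappa>\<^sup>2 * u t) * sn \<kappa> t)) (at t within {0..l})"
      by (intro has_vector_derivative_diff has_vector_derivative_mult derivs t)
    then show ?thesis by (simp add: algebra_simps)
  qed
  from primitive_derivative[OF this t]
  show "u t * cs \<kappa> t - v t * sn \<kappa> t = cs_coeff \<kappa> g (u 0) t"
    by (simp add: cs_coeff_def primitive_uminus algebra_simps)
  have "((\<lambda>t. \<kappa>\<^sup>2 * (u t * sn \<kappa> t) + v t * cs \<kappa> t) has_vector_derivative
      - (\<kappa>\<^sup>2 * (sn \<kappa> t * primitive g t))) (at t within {0..l})" if t: "t \<in> {0..l}" for t
  proof -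
    have "((\<lambda>t. \<kappa>\<^sup>2 * (u t * sn \<kappa> t) + v t * cs \<kappa> t) has_vector_derivative
      \<kappa>\<^sup>2 * (u t * cs \<kappa> t + (v t - primitive g t) * sn \<kappa> t)
        + (v t * - (\<kappa>\<^sup>2 * sn \<kappa> t) + - (\<kappa>\<^sup>2 * u t) * cs \<kappa> t)) (at t within {0..l})"
      by (intro has_vector_derivative_add has_vector_derivative_mult
          has_vector_derivative_mult_right derivs t)
    then show ?thesis by (simp add: algebra_simps)
  qed
  from primitive_derivative[OF this t, unfolded primitive_uminus primitive_cmult]
  show "\<kappa>\<^sup>2 * (u t * sn \<kappa> t) + v t * cs \<kappa> t = sn_coeff \<kappa> g (v 0) t"
    by (simp add: sn_coeff_def algebra_simps)
qed

lemma H2sol_eq_edge_sol: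
  assumes "\<kappa> \<noteq> 0" "l > 0" "sqint l g" "H2sol l u (\<lambda>t. - (g t + \<kappa>\<^sup>2 * u t))" "t \<in> {0..l}"
  shows "u t = edge_sol \<kappa> g (u 0) (dv l u 0) t"
proof -
  obtain v where sys: "edge_system l (\<kappa>\<^sup>2) g u v"
    by (rule H2sol_imp_edge_system[OF assms(3,4)])
  have "dv l u 0 = v 0" using dv_eq[OF edge_systemD(1)[OF sys], of 0] assms(2) by simp
  have "u t = u t * ((cs \<kappa> t)\<^sup>2 + \<kappa>\<^sup>2 * (sn \<kappa> t)\<^sup>2)"
    unfolding cs_square_add_sn_square[OF assms(1)] by simp
  also have "\<dots> = cs_coeff \<kappa> g (u 0) t * cs \<kappa> t + sn_coeff \<kappa> g (v 0) t * sn \<kappa> t"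
    unfolding edge_system_coeffs[OF assms(1) sys assms(5), symmetric]
    by (simp add: algebra_simps power2_eq_square)
  finally show ?thesis by (simp add: edge_sol_def \<open>dv l u 0 = v 0\<close>)
qed

lemma
  assumes g: "sqint l g" and t: "t \<in> {0..l}"
  shows norm_cs_coeff_le:
      "cmod (cs_coeff \<kappa> g \<alpha> t) \<le> cmod \<alpha> + edge_norm l (cs \<kappa>) * (l * edge_norm l g)"
    and norm_sn_coeff_le:
      "cmod (sn_coeff \<kappa> g \<beta> t) \<le> cmod \<beta> + cmod (\<kappa>\<^sup>2) * (edge_norm l (sn \<kappa>) * (l * edge_norm l g))"
proof -
  note bound = norm_primitive_mult_primitive_le[OF sqint_continuous g t]
  show "cmod (cs_coeff \<kappa> g \<alpha> t) \<le> cmod \<alpha> + edge_norm l (cs \<kappa>) * (l * edge_norm l g)"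
    unfolding cs_coeff_def
    by (intro order_trans[OF norm_triangle_ineq4] add_mono bound continuous_on_cs order_refl)
  show "cmod (sn_coeff \<kappa> g \<beta> t) \<le> cmod \<beta> + cmod (\<kappa>\<^sup>2) * (edge_norm l (sn \<kappa>) * (l * edge_norm l g))"
    unfolding sn_coeff_def
    by (intro order_trans[OF norm_triangle_ineq4] add_mono order_refl)
      (auto simp: norm_mult intro!: mult_left_mono bound continuous_on_sn)
qed

lemma edge_coeffs_bound:
  assumes "l \<ge> 0"
  obtains c where "c \<ge> 0"
    "\<And>g \<alpha> \<beta> t. sqint l g \<Longrightarrow> t \<in> {0..l} \<Longrightarrow>
      cmod (cs_coeff \<kappa> g \<alpha> t) \<le> c * (edge_norm l g + cmod \<alpha> + cmod \<beta>) \<and>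
      cmod (sn_coeff \<kappa> g \<beta> t) \<le> c * (edge_norm l g + cmod \<alpha> + cmod \<beta>) \<and>
      cmod (primitive g t) \<le> c * (edge_norm l g + cmod \<alpha> + cmod \<beta>)"
proof -
  define p q where "p = edge_norm l (cs \<kappa>) * l" and "q = cmod (\<kappa>\<^sup>2) * edge_norm l (sn \<kappa>) * l"
  have nonneg: "0 \<le> p" "0 \<le> q" using assms by (simp_all add: p_def q_def edge_norm_nonneg)
  show thesis
  proof (rule that[of "1 + p + q + sqrt l"])
    show "0 \<le> 1 + p + q + sqrt l" using nonneg assms by simp
    fix g \<alpha> \<beta> t assume g: "sqint l g" and t: "t \<in> {0..l}"
    let ?R = "edge_norm l g + cmod \<alpha> + cmod \<beta>" and ?c = "1 + p + q + sqrt l"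
    have "cmod (cs_coeff \<kappa> g \<alpha> t) \<le> cmod \<alpha> + p * edge_norm l g"
      "cmod (sn_coeff \<kappa> g \<beta> t) \<le> cmod \<beta> + q * edge_norm l g"
      "cmod (primitive g t) \<le> sqrt l * edge_norm l g"
      using norm_cs_coeff_le[OF g t] norm_sn_coeff_le[OF g t] norm_primitive_le[OF g t]
      by (simp_all add: p_def q_def mult.assoc)
    moreover have "cmod \<alpha> + p * edge_norm l g \<le> ?c * ?R" "cmod \<beta> + q * edge_norm l g \<le> ?c * ?R"
      "sqrt l * edge_norm l g \<le> ?c * ?R"
      using nonneg assms edge_norm_nonneg[of l g]
      by (auto simp: algebra_simps intro!: add_increasing add_nonneg_nonneg)
    ultimately show "cmod (cs_coeff \<kappa> g \<alpha> t) \<le> ?c * ?R \<and> cmod (sn_coeff \<kappa> g \<beta> t) \<le> ?c * ?R \<and>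
        cmod (primitive g t) \<le> ?c * ?R" by linarith
  qed
qed

lemma edge_sol_bound:
  assumes "l \<ge> 0"
  obtains K where
    "\<And>g \<alpha> \<beta> t. sqint l g \<Longrightarrow> t \<in> {0..l} \<Longrightarrow>
      cmod (edge_sol \<kappa> g \<alpha> \<beta> t) \<le> K * (edge_norm l g + cmod \<alpha> + cmod \<beta>) \<and>
      cmod (edge_slope \<kappa> g \<alpha> \<beta> t) \<le> K * (edge_norm l g + cmod \<alpha> + cmod \<beta>)"
proof -
  obtain c where c: "c \<ge> 0" "\<And>g \<alpha> \<beta> t. sqint l g \<Longrightarrow> t \<in> {0..l} \<Longrightarrow>
      cmod (cs_coeff \<kappa> g \<alpha> t) \<le> c * (edge_norm l g + cmod \<alpha> + cmod \<beta>) \<and>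
      cmod (sn_coeff \<kappa> g \<beta> t) \<le> c * (edge_norm l g + cmod \<alpha> + cmod \<beta>) \<and>
      cmod (primitive g t) \<le> c * (edge_norm l g + cmod \<alpha> + cmod \<beta>)"
    by (rule edge_coeffs_bound[OF assms, of \<kappa>]) blast
  obtain M where M: "M \<ge> 0" "\<And>t. t \<in> {0..l} \<Longrightarrow> cmod (cs \<kappa> t) \<le> M"
    using continuous_on_compact_bound[OF compact_Icc continuous_on_cs] by blast
  obtain N where N: "N \<ge> 0" "\<And>t. t \<in> {0..l} \<Longrightarrow> cmod (sn \<kappa> t) \<le> N"
    using continuous_on_compact_bound[OF compact_Icc continuous_on_sn] by blast
  define m where "m = cmod (\<kappa>\<^sup>2)"
  show thesis
  proof (rule that[of "c * (M + N) + c * (M + m * N + 1)"])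
    fix g \<alpha> \<beta> t assume g: "sqint l g" and t: "t \<in> {0..l}"
    define R where "R = edge_norm l g + cmod \<alpha> + cmod \<beta>"
    have coeff: "cmod (cs_coeff \<kappa> g \<alpha> t) \<le> c * R" "cmod (sn_coeff \<kappa> g \<beta> t) \<le> c * R"
      "cmod (primitive g t) \<le> c * R"
      using c(2)[OF g t, of \<alpha> \<beta>] by (simp_all add: R_def)
    have mult: "cmod (x * y) \<le> X * Y" if "cmod x \<le> X" "cmod y \<le> Y" for x y X Y
      unfolding norm_mult using that by (intro mult_mono) (auto intro: order_trans[OF norm_ge_zero])
    have "cmod (edge_sol \<kappa> g \<alpha> \<beta> t) \<le> c * R * M + c * R * N"
      unfolding edge_sol_def
      by (intro order_trans[OF norm_triangle_ineq] add_mono mult coeff M N t)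
    moreover have "cmod (edge_slope \<kappa> g \<alpha> \<beta> t) \<le> c * R * M + m * (c * R) * N + c * R"
      unfolding edge_slope_def
      by (intro order_trans[OF norm_triangle_ineq4] add_mono mult coeff M N t) (simp add: m_def)
    moreover have "0 \<le> c * R * M" "0 \<le> c * R * N" "0 \<le> m * (c * R) * N" "0 \<le> c * R"
      using c(1) M(1) N(1) by (simp_all add: m_def R_def edge_norm_nonneg)
    ultimately show "cmod (edge_sol \<kappa> g \<alpha> \<beta> t) \<le> (c * (M + N) + c * (M + m * N + 1)) * R \<and>
      cmod (edge_slope \<kappa> g \<alpha> \<beta> t) \<le> (c * (M + N) + c * (M + m * N + 1)) * R"
      by (simp add: algebra_simps)
  qed
qed

text \<open>Green's formula against this function picks out the end point \<open>l\<close>, where only its derivative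
  is nonzero.\<close>

definition end_bump :: "real \<Rightarrow> real \<Rightarrow> complex" where
  "end_bump l t = of_real (t\<^sup>2 * (t - l))"

definition end_bump' :: "real \<Rightarrow> real \<Rightarrow> complex" where
  "end_bump' l t = of_real (3 * t\<^sup>2 - 2 * l * t)"

definition end_bump'' :: "real \<Rightarrow> real \<Rightarrow> complex" where
  "end_bump'' l t = of_real (6 * t - 2 * l)"

lemma end_bump_has_vector_derivative:
  "(end_bump l has_vector_derivative end_bump' l t) (at t within S)"
  "(end_bump' l has_vector_derivative end_bump'' l t) (at t within S)"
  unfolding end_bump_def[abs_def] end_bump'_def[abs_def] end_bump''_def[abs_def]
  by (rule has_vector_derivative_of_real;
      auto intro!: derivative_eq_intros simp: power2_eq_square algebra_simps)+

lemma continuous_on_end_bump: "continuous_on S (end_bump l)"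
  and continuous_on_end_bump': "continuous_on S (end_bump' l)"
  and continuous_on_end_bump'': "continuous_on S (end_bump'' l)"
  unfolding end_bump_def[abs_def] end_bump'_def[abs_def] end_bump''_def[abs_def]
  by (intro continuous_intros)+

lemma end_bump_endpoints:
  "end_bump l 0 = 0" "end_bump l l = 0" "end_bump' l 0 = 0" "end_bump' l l = of_real (l\<^sup>2)"
  by (simp_all add: end_bump_def end_bump'_def power2_eq_square)

lemma end_bump_green:
  assumes g: "sqint l g" and sys: "edge_system l E g u v" and l: "l \<in> {0..l}"
  defines "k \<equiv> \<lambda>t. end_bump'' l t + E * end_bump l t"
  shows "of_real (l\<^sup>2) * u l
    = primitive (\<lambda>t. u t * k t) l - primitive (\<lambda>t. end_bump' l t * primitive g t) l"
proof -
  have "continuous_on {0..l} k"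
    unfolding k_def by (intro continuous_intros continuous_on_end_bump continuous_on_end_bump'')
  then have sqint: "sqint l (\<lambda>t. u t * k t)" "sqint l (\<lambda>t. - (end_bump' l t * primitive g t))"
    by (intro sqint_continuous continuous_intros continuous_on_edge_system[OF sys]
        continuous_on_end_bump' continuous_on_primitive g; assumption)+
  have "((\<lambda>t. u t * end_bump' l t - v t * end_bump l t) has_vector_derivative
      u t * k t + - (end_bump' l t * primitive g t)) (at t within {0..l})" if t: "t \<in> {0..l}" for t
  proof -
    have "((\<lambda>t. u t * end_bump' l t - v t * end_bump l t) has_vector_derivative
      (u t * end_bump'' l t + (v t - primitive g t) * end_bump' l t)
      - (v t * end_bump' l t + - (E * u t) * end_bump l t)) (at t within {0..l})"
      by (intro has_vector_derivative_diff has_vector_derivative_mult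
          edge_systemD[OF sys t] end_bump_has_vector_derivative)
    then show ?thesis by (simp add: k_def algebra_simps)
  qed
  from primitive_derivative[OF this l, unfolded primitive_add[OF sqint l] primitive_uminus]
  show ?thesis by (simp add: end_bump_endpoints mult.commute)
qed

lemma H2sol_end_value_bound:
  assumes "l > 0"
  obtains K where "\<And>g u. sqint l g \<Longrightarrow> H2sol l u (\<lambda>t. - (g t + E * u t)) \<Longrightarrow>
    cmod (u l) \<le> K * (edge_norm l u + edge_norm l g)"
proof -
  define k where "k t = end_bump'' l t + E * end_bump l t" for t
  define p q where "p = edge_norm l k" and "q = edge_norm l (end_bump' l) * l"
  have nonneg: "0 \<le> p" "0 \<le> q" using assms by (simp_all add: p_def q_def edge_norm_nonneg)
  have sqint: "sqint l k" "sqint l (end_bump' l)"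
    unfolding k_def[abs_def] by (intro sqint_continuous continuous_intros
        continuous_on_end_bump continuous_on_end_bump' continuous_on_end_bump'')+
  show thesis
  proof (rule that[of "(p + q) / l\<^sup>2"])
    fix g u assume g: "sqint l g" and "H2sol l u (\<lambda>t. - (g t + E * u t))"
    then obtain v where sys: "edge_system l E g u v" by (rule H2sol_imp_edge_system)
    have l: "l \<in> {0..l}" using assms by simp
    have "l\<^sup>2 * cmod (u l) = cmod (of_real (l\<^sup>2) * u l)" by (simp add: norm_mult norm_power)
    also have "\<dots> \<le> cmod (primitive (\<lambda>t. u t * k t) l)
        + cmod (primitive (\<lambda>t. end_bump' l t * primitive g t) l)"
      unfolding end_bump_green[OF g sys l, folded k_def] by (rule norm_triangle_ineq4)
    also have "\<dots> \<le> edge_norm l u * p + edge_norm l (end_bump' l) * (l * edge_norm l g)"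
      unfolding p_def
      by (intro add_mono norm_primitive_mult_le norm_primitive_mult_primitive_le sqint g l
          sqint_continuous continuous_on_edge_system[OF sys])
    also have "\<dots> \<le> (p + q) * (edge_norm l u + edge_norm l g)"
      using mult_nonneg_nonneg[OF nonneg(1) edge_norm_nonneg[of l g]]
        mult_nonneg_nonneg[OF nonneg(2) edge_norm_nonneg[of l u]]
      by (simp add: q_def algebra_simps)
    finally show "cmod (u l) \<le> (p + q) / l\<^sup>2 * (edge_norm l u + edge_norm l g)"
      using assms by (simp add: field_simps)
  qed
qed

lemma ex_end_slope_source:
  assumes "\<kappa> \<noteq> 0" "l > 0"
  obtains h where "sqint l h" "edge_sol \<kappa> h 0 0 l = 0" "edge_slope \<kappa> h 0 0 l \<noteq> 0"
proof -
  define h where "h t = - (end_bump'' l t + \<kappa>\<^sup>2 * end_bump l t)" for t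
  have l: "l \<in> {0..l}" using assms(2) by simp
  have h: "sqint l h"
    unfolding h_def[abs_def]
    by (intro sqint_continuous continuous_intros continuous_on_end_bump continuous_on_end_bump'')
  have "H2sol l (end_bump l) (\<lambda>t. - (h t + \<kappa>\<^sup>2 * end_bump l t))"
    using H2sol_of_C2[OF end_bump_has_vector_derivative continuous_on_end_bump'']
    by (simp add: h_def)
  from H2sol_eq_edge_sol[OF assms h this]
  have edge_sol: "edge_sol \<kappa> h 0 0 t = end_bump l t" if "t \<in> {0..l}" for t
    using that assms(2) dv_eq[OF end_bump_has_vector_derivative(1), of 0 l l]
    by (simp add: end_bump_endpoints)
  have "edge_slope \<kappa> h 0 0 l = dv l (end_bump l) l"
    using dv_cong[of l "edge_sol \<kappa> h 0 0" "end_bump l", OF edge_sol l]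
      dv_edge_sol[OF assms(1) h l assms(2)] by simp
  also have "\<dots> = of_real (l\<^sup>2)"
    using dv_eq[OF end_bump_has_vector_derivative(1) l assms(2)] by (simp add: end_bump_endpoints)
  finally show thesis using that[OF h] edge_sol[OF l] assms(2) by (simp add: end_bump_endpoints)
qed

subsection \<open>Square-summable sequences\<close>

definition ell2 :: "('a \<Rightarrow> 'b::real_normed_vector) \<Rightarrow> bool" where
  "ell2 y \<longleftrightarrow> (\<lambda>j. (norm (y j))\<^sup>2) summable_on UNIV"

lemma ell2_comparison:
  fixes x :: "'a \<Rightarrow> real"
  assumes "ell2 x" "\<And>j. norm (y j) \<le> x j"
  shows "ell2 y"
  unfolding ell2_def
  by (rule summable_on_comparison_test[OF assms(1)[unfolded ell2_def]])
    (simp_all add: assms(2) power_mono)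

lemma ell2_norm: "ell2 x \<Longrightarrow> ell2 (\<lambda>j. norm (x j))"
  by (simp add: ell2_def)

lemma ell2_zero: "ell2 (\<lambda>_. 0)"
  by (simp add: ell2_def)

lemma ell2_add:
  assumes "ell2 x" "ell2 y"
  shows "ell2 (\<lambda>j. x j + y j)"
  unfolding ell2_def
proof (rule summable_on_comparison_test)
  show "(\<lambda>j. 2 * ((norm (x j))\<^sup>2 + (norm (y j))\<^sup>2)) summable_on UNIV"
    using assms unfolding ell2_def by (intro summable_on_cmult_right summable_on_add)
qed (simp_all only: norm_add_square_le zero_le_power2)

lemma ell2_cmult:
  fixes x :: "'a \<Rightarrow> 'b::real_normed_field"
  shows "ell2 x \<Longrightarrow> ell2 (\<lambda>j. c * x j)"
  unfolding ell2_def norm_mult power_mult_distrib by (rule summable_on_cmult_right)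

lemma ell2_mult_const:
  fixes x :: "'a \<Rightarrow> 'b::real_normed_field"
  shows "ell2 x \<Longrightarrow> ell2 (\<lambda>j. x j * c)"
  using ell2_cmult[of x c] by (simp add: mult.commute)

lemma ell2_divide:
  fixes x :: "'a \<Rightarrow> 'b::real_normed_field"
  shows "ell2 x \<Longrightarrow> ell2 (\<lambda>j. x j / c)"
  unfolding divide_inverse by (rule ell2_mult_const)

lemma ell2_diff: "ell2 x \<Longrightarrow> ell2 y \<Longrightarrow> ell2 (\<lambda>j. x j - y j)"
  using ell2_add[of x "\<lambda>j. - y j"] by (simp add: ell2_def)

lemmas ell2_intros = ell2_zero ell2_add ell2_diff ell2_cmult ell2_mult_const ell2_divide

lemma ell2_shift:
  fixes x :: "'a::ab_group_add \<Rightarrow> 'b::real_normed_vector"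
  shows "ell2 x \<Longrightarrow> ell2 (\<lambda>j. x (j + k))"
  unfolding ell2_def
  using summable_on_reindex_bij_betw[of "\<lambda>j. j + k" UNIV UNIV "\<lambda>j. (norm (x j))\<^sup>2"]
  by (simp add: bij_plus_right)

lemma ell2_tendsto_zero:
  fixes \<phi> :: "nat \<Rightarrow> 'a"
  assumes "ell2 y" "inj \<phi>"
  shows "(\<lambda>n. y (\<phi> n)) \<longlonglongrightarrow> 0"
proof -
  have "(\<lambda>j. (norm (y j))\<^sup>2) summable_on range \<phi>"
    by (rule summable_on_subset_banach[OF assms(1)[unfolded ell2_def]]) simp
  then have "(\<lambda>n. (norm (y (\<phi> n)))\<^sup>2) summable_on UNIV"
    by (subst (asm) summable_on_reindex[OF assms(2)]) (simp add: comp_def)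
  from tendsto_real_sqrt[OF summable_LIMSEQ_zero[OF summable_on_imp_summable[OF this]]]
  have "(\<lambda>n. norm (y (\<phi> n))) \<longlonglongrightarrow> 0" by simp
  then show ?thesis by (rule tendsto_norm_zero_cancel)
qed

lemma summable_on_power_abs:
  assumes "0 \<le> r" "r < (1::real)"
  shows "(\<lambda>j::int. r ^ nat \<bar>j\<bar>) summable_on UNIV"
proof -
  have geometric: "(\<lambda>n. r ^ n) summable_on UNIV"
    using assms by (subst summable_on_UNIV_nonneg_real_iff) (auto intro: summable_geometric)
  have nonneg: "(\<lambda>j. r ^ nat \<bar>j\<bar>) summable_on range int"
    by (subst summable_on_reindex) (use geometric in \<open>auto simp: comp_def\<close>)
  have nonpos: "(\<lambda>j. r ^ nat \<bar>j\<bar>) summable_on range (\<lambda>n. - int n)"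
    by (subst summable_on_reindex) (use geometric in \<open>auto simp: comp_def inj_on_def\<close>)
  have "j \<in> range int \<union> range (\<lambda>n. - int n)" for j
    by (cases j rule: int_cases2) auto
  then have "range int \<union> range (\<lambda>n. - int n) = UNIV" by blast
  with summable_on_union[OF nonneg nonpos] show ?thesis by simp
qed

lemma ell2_power_abs:
  fixes z :: "'b::real_normed_field"
  assumes "norm z < 1"
  shows "ell2 (\<lambda>j. z ^ nat \<bar>j\<bar>)"
proof -
  have "(\<lambda>j. ((norm z)\<^sup>2) ^ nat \<bar>j\<bar>) summable_on UNIV"
    using assms by (intro summable_on_power_abs) (simp_all add: abs_square_less_1)
  then show ?thesis
    by (simp add: ell2_def norm_power flip: power_mult) (simp add: mult.commute)
qed

lemma
  fixes f g :: "'a \<Rightarrow> real"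
  assumes f: "(\<lambda>i. (f i)\<^sup>2) summable_on A" and g: "(\<lambda>i. (g i)\<^sup>2) summable_on A"
  shows summable_on_abs_mult_of_squares: "(\<lambda>i. \<bar>f i * g i\<bar>) summable_on A"
    and Cauchy_Schwarz_infsum:
      "(\<Sum>\<^sub>\<infinity>i\<in>A. \<bar>f i * g i\<bar>)\<^sup>2 \<le> (\<Sum>\<^sub>\<infinity>i\<in>A. (f i)\<^sup>2) * (\<Sum>\<^sub>\<infinity>i\<in>A. (g i)\<^sup>2)"
proof -
  show abs: "(\<lambda>i. \<bar>f i * g i\<bar>) summable_on A"
    using abs_summable_product[of f A g] f g by (simp add: power2_eq_square)
  have nonneg: "0 \<le> (\<Sum>\<^sub>\<infinity>i\<in>A. (f i)\<^sup>2)" "0 \<le> (\<Sum>\<^sub>\<infinity>i\<in>A. (g i)\<^sup>2)"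
    by (simp_all add: infsum_nonneg)
  have "(\<Sum>i\<in>I. \<bar>f i * g i\<bar>) \<le> sqrt ((\<Sum>\<^sub>\<infinity>i\<in>A. (f i)\<^sup>2) * (\<Sum>\<^sub>\<infinity>i\<in>A. (g i)\<^sup>2))"
    if "finite I" "I \<subseteq> A" for I
  proof (rule real_le_rsqrt)
    have "(\<Sum>i\<in>I. \<bar>f i * g i\<bar>)\<^sup>2 \<le> (\<Sum>i\<in>I. (f i)\<^sup>2) * (\<Sum>i\<in>I. (g i)\<^sup>2)"
      using Cauchy_Schwarz_ineq_sum[of "\<lambda>i. \<bar>f i\<bar>" "\<lambda>i. \<bar>g i\<bar>" I] by (simp add: abs_mult)
    also have "\<dots> \<le> (\<Sum>\<^sub>\<infinity>i\<in>A. (f i)\<^sup>2) * (\<Sum>\<^sub>\<infinity>i\<in>A. (g i)\<^sup>2)"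
      by (intro mult_mono finite_sum_le_infsum f g that nonneg) (simp_all add: sum_nonneg)
    finally show "(\<Sum>i\<in>I. \<bar>f i * g i\<bar>)\<^sup>2 \<le> (\<Sum>\<^sub>\<infinity>i\<in>A. (f i)\<^sup>2) * (\<Sum>\<^sub>\<infinity>i\<in>A. (g i)\<^sup>2)" .
  qed
  then have "(\<Sum>\<^sub>\<infinity>i\<in>A. \<bar>f i * g i\<bar>) \<le> sqrt ((\<Sum>\<^sub>\<infinity>i\<in>A. (f i)\<^sup>2) * (\<Sum>\<^sub>\<infinity>i\<in>A. (g i)\<^sup>2))"
    using abs by (intro infsum_le_finite_sums) simp_all
  then have "(\<Sum>\<^sub>\<infinity>i\<in>A. \<bar>f i * g i\<bar>)\<^sup>2 \<le> (sqrt ((\<Sum>\<^sub>\<infinity>i\<in>A. (f i)\<^sup>2) * (\<Sum>\<^sub>\<infinity>i\<in>A. (g i)\<^sup>2)))\<^sup>2"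
    by (intro power_mono infsum_nonneg) auto
  then show "(\<Sum>\<^sub>\<infinity>i\<in>A. \<bar>f i * g i\<bar>)\<^sup>2 \<le> (\<Sum>\<^sub>\<infinity>i\<in>A. (f i)\<^sup>2) * (\<Sum>\<^sub>\<infinity>i\<in>A. (g i)\<^sup>2)"
    by (simp add: nonneg)
qed

lemma summable_on_convolution:
  fixes w k :: "'a::ab_group_add \<Rightarrow> real"
  assumes w: "w summable_on UNIV" "\<And>m. 0 \<le> w m" and k: "k summable_on UNIV" "\<And>j. 0 \<le> k j"
  shows "(\<lambda>m. w m * k (j - m)) summable_on UNIV"
    and "(\<lambda>j. \<Sum>\<^sub>\<infinity>m. w m * k (j - m)) summable_on UNIV"
proof -
  have "(\<lambda>(m, j). w m * k (j - m)) summable_on UNIV \<times> UNIV"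
  proof (rule summable_on_SigmaI)
    fix m :: 'a
    have "bij (\<lambda>j. j - m)" using bij_plus_right[of "- m"] by simp
    from has_sum_reindex_bij_betw[OF this, of k]
    have "((\<lambda>j. k (j - m)) has_sum infsum k UNIV) UNIV" using k(1) by simp
    then show "((\<lambda>j. case (m, j) of (m, j) \<Rightarrow> w m * k (j - m)) has_sum w m * infsum k UNIV) UNIV"
      by (simp add: has_sum_cmult_right)
  qed (use w k in \<open>auto intro: summable_on_cmult_left\<close>)
  then have swapped: "(\<lambda>(j, m). w m * k (j - m)) summable_on UNIV \<times> UNIV"
    by (subst (asm) summable_on_swap) simp
  show "(\<lambda>m. w m * k (j - m)) summable_on UNIV"
    using summable_on_SigmaD1[OF swapped, of j] by simp
  show "(\<lambda>j. \<Sum>\<^sub>\<infinity>m. w m * k (j - m)) summable_on UNIV"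
    using summable_on_Sigma_banach[OF swapped] by simp
qed

text \<open>Young's inequality, from Cauchy--Schwarz for \<open>|w h| = |w|\<^sup>1\<^sup>/\<^sup>2 \<cdot> |w|\<^sup>1\<^sup>/\<^sup>2 |h|\<close>.\<close>

lemma
  fixes w h :: "'a::ab_group_add \<Rightarrow> 'b::{real_normed_field, banach}"
  assumes w: "(\<lambda>m. norm (w m)) summable_on UNIV" and h: "ell2 h"
  shows abs_summable_on_convolution: "(\<lambda>m. norm (w m * h (j - m))) summable_on UNIV"
    and ell2_convolution: "ell2 (\<lambda>j. \<Sum>\<^sub>\<infinity>m. w m * h (j - m))"
proof -
  define k where "k j = (\<Sum>\<^sub>\<infinity>m. norm (w m) * (norm (h (j - m)))\<^sup>2)" for j
  note summable = summable_on_convolution[OF w norm_ge_zero h[unfolded ell2_def] zero_le_power2]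
  have squares: "(\<lambda>m. (sqrt (norm (w m)))\<^sup>2) summable_on UNIV"
    "(\<lambda>m. (sqrt (norm (w m)) * norm (h (j - m)))\<^sup>2) summable_on UNIV" for j
    using w summable(1)[of j] by (simp_all add: power_mult_distrib)
  have product: "\<bar>sqrt (norm (w m)) * (sqrt (norm (w m)) * norm (h (j - m)))\<bar>
      = norm (w m * h (j - m))" for m j
    by (simp add: abs_mult norm_mult flip: mult.assoc)
  show abs: "(\<lambda>m. norm (w m * h (j - m))) summable_on UNIV" for j
    using summable_on_abs_mult_of_squares[OF squares(1) squares(2)[of j]] unfolding product .
  show "ell2 (\<lambda>j. \<Sum>\<^sub>\<infinity>m. w m * h (j - m))"
    unfolding ell2_def
  proof (rule summable_on_comparison_test)
    show "(\<lambda>j. (\<Sum>\<^sub>\<infinity>m. norm (w m)) * k j) summable_on UNIV"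
      unfolding k_def by (intro summable_on_cmult_right summable(2))
    fix j
    have "norm (\<Sum>\<^sub>\<infinity>m. w m * h (j - m)) \<le> (\<Sum>\<^sub>\<infinity>m. norm (w m * h (j - m)))"
      by (rule norm_infsum_bound[OF abs])
    then have "(norm (\<Sum>\<^sub>\<infinity>m. w m * h (j - m)))\<^sup>2 \<le> (\<Sum>\<^sub>\<infinity>m. norm (w m * h (j - m)))\<^sup>2"
      by (intro power_mono) auto
    also have "\<dots> \<le> (\<Sum>\<^sub>\<infinity>m. norm (w m)) * k j"
      using Cauchy_Schwarz_infsum[OF squares(1) squares(2)[of j]]
      unfolding product k_def by (simp add: power_mult_distrib)
    finally show "(norm (\<Sum>\<^sub>\<infinity>m. w m * h (j - m)))\<^sup>2 \<le> (\<Sum>\<^sub>\<infinity>m. norm (w m)) * k j" .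
  qed (rule zero_le_power2)
qed

subsection \<open>The three-term recurrence with a single defect\<close>

definition jacobi :: "(int \<Rightarrow> complex) \<Rightarrow> (int \<Rightarrow> complex) \<Rightarrow> int \<Rightarrow> complex" where
  "jacobi q y j = y (j + 1) + y (j - 1) - 2 * q j * y j"

lemma jacobi_power_abs:
  assumes "z \<noteq> 0" "z + 1 / z = 2 * F"
  shows "jacobi ((\<lambda>_. F)(0 := G)) (\<lambda>j. z ^ nat \<bar>j\<bar>) j = (if j = 0 then 2 * (z - G) else 0)"
proof -
  have recurrence: "z ^ Suc (Suc n) + z ^ n - 2 * F * z ^ Suc n = 0" for n
    unfolding assms(2)[symmetric] using assms(1) by (simp add: field_simps)
  consider "j = 0" | n where "j = 1 + int n" | n where "j = - 1 - int n"
    by (cases j rule: int_cases3) (auto dest!: gr0_implies_Suc)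
  then show ?thesis
  proof cases
    case (2 n)
    then have nat_abs: "nat \<bar>j + 1\<bar> = Suc (Suc n)" "nat \<bar>j - 1\<bar> = n" "nat \<bar>j\<bar> = Suc n" by auto
    show ?thesis unfolding jacobi_def nat_abs using recurrence[of n] 2 by simp
  next
    case (3 n)
    then have nat_abs: "nat \<bar>j - 1\<bar> = Suc (Suc n)" "nat \<bar>j + 1\<bar> = n" "nat \<bar>j\<bar> = Suc n" by auto
    show ?thesis unfolding jacobi_def nat_abs using recurrence[of n] 3 by (simp add: algebra_simps)
  qed (simp add: jacobi_def)
qed

lemma jacobi_convolution:
  assumes w: "(\<lambda>m. cmod (w m)) summable_on UNIV" and h: "ell2 h"
  shows "((\<lambda>m. jacobi (\<lambda>_. F) w m * h (j - m)) has_sum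
    jacobi (\<lambda>_. F) (\<lambda>j. \<Sum>\<^sub>\<infinity>m. w m * h (j - m)) j) UNIV"
proof -
  define x where "x j = (\<Sum>\<^sub>\<infinity>m. w m * h (j - m))" for j
  have x: "((\<lambda>m. w (m + k) * h (j - m)) has_sum x (j + k)) UNIV" for j k
  proof -
    have "((\<lambda>m. w m * h (j + k - m)) has_sum x (j + k)) UNIV"
      unfolding x_def
      by (rule has_sum_infsum[OF abs_summable_summable[OF abs_summable_on_convolution[OF w h]]])
    with has_sum_reindex_bij_betw[OF bij_plus_right, of "\<lambda>m. w m * h (j + k - m)" k]
    show ?thesis by (simp add: algebra_simps)
  qed
  have "((\<lambda>m. w (m + 1) * h (j - m) + w (m + - 1) * h (j - m) + (- 2 * F) * (w (m + 0) * h (j - m)))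
      has_sum x (j + 1) + x (j + - 1) + (- 2 * F) * x (j + 0)) UNIV"
    by (intro has_sum_add has_sum_cmult_right x)
  then show ?thesis by (simp add: jacobi_def x_def algebra_simps)
qed

lemma jacobi_const_solvable:
  assumes z: "z \<noteq> 0" "cmod z < 1" "z + 1 / z = 2 * F" and h: "ell2 h"
  obtains x where "ell2 x" "jacobi (\<lambda>_. F) x = h"
proof -
  define w where "w j = z ^ nat \<bar>j\<bar>" for j :: int
  have w: "(\<lambda>j. cmod (w j)) summable_on UNIV"
    using summable_on_power_abs[of "cmod z"] z(2) by (simp add: w_def[abs_def] norm_power)
  have "z \<noteq> F"
  proof
    assume "z = F"
    then have "z * z = 1" using z(1,3) by (simp add: field_simps)
    then have "cmod z * cmod z = 1" by (metis norm_mult norm_one)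
    then show False using z(2) mult_strict_mono[of "cmod z" 1 "cmod z" 1] by simp
  qed
  define x where "x j = (\<Sum>\<^sub>\<infinity>m. w m * h (j - m)) / (2 * (z - F))" for j
  have no_defect: "(\<lambda>_. F)(0 := F) = (\<lambda>_::int. F)" by auto
  have "((\<lambda>m. jacobi (\<lambda>_. F) w m * h (j - m)) has_sum 2 * (z - F) * h j) UNIV" for j
    using jacobi_power_abs[OF z(1,3), of F] unfolding no_defect
    by (intro has_sum_finite_neutralI[of "{0}"]) (simp_all add: w_def[abs_def])
  from has_sum_unique[OF jacobi_convolution[OF w h] this]
  have "jacobi (\<lambda>_. F) (\<lambda>j. \<Sum>\<^sub>\<infinity>m. w m * h (j - m)) j / (2 * (z - F)) = h j" for j
    using \<open>z \<noteq> F\<close> by simp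
  then have "jacobi (\<lambda>_. F) x j = h j" for j
    unfolding x_def jacobi_def by (simp add: add_divide_distrib diff_divide_distrib)
  moreover have "ell2 x"
    unfolding x_def by (rule ell2_divide[OF ell2_convolution[OF w h]])
  ultimately show thesis using that by blast
qed

lemma jacobi_solvable:
  assumes z: "z \<noteq> 0" "cmod z < 1" "z + 1 / z = 2 * F" and "G \<noteq> z" and h: "ell2 h"
  obtains y where "ell2 y" "jacobi ((\<lambda>_. F)(0 := G)) y = h"
proof -
  obtain x where x: "ell2 x" "jacobi (\<lambda>_. F) x = h"
    by (rule jacobi_const_solvable[OF z h])
  define w where "w j = z ^ nat \<bar>j\<bar>" for j :: int
  define c where "c = (G - F) * x 0 / (z - G)"
  have "jacobi ((\<lambda>_. F)(0 := G)) (\<lambda>j. x j + c * w j) j = h j" for j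
  proof -
    have "jacobi ((\<lambda>_. F)(0 := G)) (\<lambda>j. x j + c * w j) j
      = jacobi (\<lambda>_. F) x j - (if j = 0 then 2 * (G - F) * x 0 else 0)
        + c * jacobi ((\<lambda>_. F)(0 := G)) w j"
      by (simp add: jacobi_def algebra_simps)
    also have "\<dots> = h j"
      unfolding x(2) w_def[abs_def] jacobi_power_abs[OF z(1,3)]
      using \<open>G \<noteq> z\<close> by (simp add: c_def field_simps)
    finally show ?thesis .
  qed
  moreover have "ell2 (\<lambda>j. x j + c * w j)"
    unfolding w_def by (intro ell2_add ell2_cmult x ell2_power_abs z)
  ultimately show thesis using that by blast
qed

lemma half_line_recurrence:
  fixes y :: "nat \<Rightarrow> complex"
  assumes z: "z \<noteq> 0" "cmod z \<le> 1"
    and rec: "\<And>n. y (Suc (Suc n)) + y n = (z + 1 / z) * y (Suc n)" and lim: "y \<longlonglongrightarrow> 0"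
  shows "y n = z ^ n * y 0"
proof -
  define w where "w n = y (Suc n) - z * y n" for n
  have w: "w n = z * w (Suc n)" for n
  proof -
    have "z * (y (Suc (Suc n)) + y n) = (z * z + 1) * y (Suc n)"
      unfolding rec using z(1) by (simp add: field_simps)
    then show ?thesis by (simp add: w_def algebra_simps)
  qed
  have "cmod (w n) \<le> cmod (w (Suc n))" for n
    using w[of n] mult_left_le_one_le[of "cmod (w (Suc n))" "cmod z"] z(2) by (simp add: norm_mult)
  then have "incseq (\<lambda>n. cmod (w n))" by (rule incseq_SucI)
  moreover have "w \<longlonglongrightarrow> 0 - z * 0"
    unfolding w_def[abs_def] by (intro tendsto_diff tendsto_mult tendsto_const LIMSEQ_Suc lim)
  ultimately have "cmod (w n) \<le> 0" for n
    by (intro incseq_le) (simp_all add: tendsto_norm_zero)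
  then have "y (Suc n) = z * y n" for n by (simp add: w_def)
  then show ?thesis by (induction n) simp_all
qed

lemma jacobi_ell2_unique:
  assumes z: "z \<noteq> 0" "cmod z \<le> 1" "z + 1 / z = 2 * F"
    and y: "ell2 y" "\<And>j. j \<noteq> 0 \<Longrightarrow> jacobi ((\<lambda>_. F)(0 := G)) y j = 0"
  shows "y j = z ^ nat \<bar>j\<bar> * y 0"
proof -
  have rec: "y (j + 1) + y (j - 1) = (z + 1 / z) * y j" if "j \<noteq> 0" for j
    using y(2)[OF that] that by (simp add: jacobi_def z(3))
  have "y (int n) = z ^ n * y (int 0)" for n
  proof (rule half_line_recurrence[OF z(1,2)])
    show "(\<lambda>n. y (int n)) \<longlonglongrightarrow> 0" by (rule ell2_tendsto_zero[OF y(1)]) simp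
    show "y (int (Suc (Suc n))) + y (int n) = (z + 1 / z) * y (int (Suc n))" for n
      using rec[of "int (Suc n)"] by (simp add: add_ac)
  qed
  moreover have "y (- int n) = z ^ n * y (- int 0)" for n
  proof (rule half_line_recurrence[OF z(1,2)])
    show "(\<lambda>n. y (- int n)) \<longlonglongrightarrow> 0" by (rule ell2_tendsto_zero[OF y(1)]) (simp add: inj_on_def)
    show "y (- int (Suc (Suc n))) + y (- int n) = (z + 1 / z) * y (- int (Suc n))" for n
      using rec[of "- int (Suc n)"] by (simp add: add_ac diff_diff_eq)
  qed
  ultimately show ?thesis by (cases j rule: int_cases2) auto
qed

lemma ex_joukowski_preimage:
  obtains z :: complex where "z \<noteq> 0" "cmod z \<le> 1" "z + 1 / z = 2 * F"
proof -
  define w where "w = F + csqrt (F\<^sup>2 - 1)"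
  have "(w - F)\<^sup>2 = F\<^sup>2 - 1" by (simp add: w_def)
  then have w: "w * (2 * F - w) = 1" by (simp add: power2_eq_square algebra_simps)
  then have "w \<noteq> 0" by auto
  with w have sum: "w + 1 / w = 2 * F" by (simp add: field_simps)
  show thesis
  proof (cases "cmod w \<le> 1")
    case True
    then show ?thesis using that \<open>w \<noteq> 0\<close> sum by blast
  next
    case False
    then show ?thesis using that[of "1 / w"] \<open>w \<noteq> 0\<close> sum by (simp add: norm_divide field_simps)
  qed
qed

definition band :: "complex set" where
  "band = complex_of_real ` {-1..1}"

lemma closed_band: "closed band"
  unfolding band_def by (intro compact_imp_closed compact_continuous_image continuous_intros) auto

lemma of_real_in_band_iff: "of_real f \<in> band \<longleftrightarrow> \<bar>f\<bar> \<le> 1"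
  by (auto simp: band_def abs_le_iff)

lemma joukowski_unit_circle_iff:
  assumes "z \<noteq> 0" "z + 1 / z = 2 * F"
  shows "cmod z = 1 \<longleftrightarrow> F \<in> band"
proof
  assume "cmod z = 1"
  then have "1 / z = cnj z" using complex_div_cnj[of 1 z] by simp
  then have "F = of_real (Re z)" using assms(2) complex_add_cnj[of z] by simp
  moreover have "\<bar>Re z\<bar> \<le> 1" using abs_Re_le_cmod[of z] \<open>cmod z = 1\<close> by simp
  ultimately show "F \<in> band" by (simp add: of_real_in_band_iff)
next
  assume "F \<in> band"
  then obtain f where f: "F = of_real f" "\<bar>f\<bar> \<le> 1" by (auto simp: band_def abs_le_iff)
  define w where "w = Complex f (sqrt (1 - f\<^sup>2))"
  have w: "cmod w = 1" using f(2) by (simp add: w_def cmod_def abs_square_le_1)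
  have "w * cnj w = 1" using w by (simp add: complex_norm_square[symmetric])
  moreover have "w + cnj w = 2 * F" using complex_add_cnj[of w] by (simp add: w_def f)
  moreover have "z * z + 1 = 2 * F * z" using assms by (simp add: field_simps)
  ultimately have "(z - w) * (z - cnj w) = 0" by algebra
  then show "cmod z = 1" using w by auto
qed

subsection \<open>Reduction of the graph equation to the vertices\<close>

type_synonym graph_fun = "int \<Rightarrow> etype \<Rightarrow> real \<Rightarrow> complex"

lemma elen_simps [simp]: "elen a b Hor = a" "elen a b Up = b / 2" "elen a b Dn = b / 2"
  by (simp_all add: elen_def)

lemma L2g_iff:
  "L2g a b g \<longleftrightarrow> (\<forall>j e. sqint (elen a b e) (g j e)) \<and>
    (\<forall>e. ell2 (\<lambda>j. edge_norm (elen a b e) (g j e)))"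
proof -
  let ?n = "\<lambda>e j. edge_norm2 (elen a b e) (g j e)"
  have "(\<lambda>j. ?n Hor j + ?n Up j + ?n Dn j) summable_on UNIV \<longleftrightarrow> (\<forall>e. ?n e summable_on UNIV)"
  proof
    assume sum: "(\<lambda>j. ?n Hor j + ?n Up j + ?n Dn j) summable_on UNIV"
    have "?n e j \<le> ?n Hor j + ?n Up j + ?n Dn j" for e j
      by (cases e) (simp_all add: edge_norm2_nonneg)
    then show "\<forall>e. ?n e summable_on UNIV"
      by (intro allI summable_on_comparison_test[OF sum]) (simp_all add: edge_norm2_nonneg)
  qed (intro summable_on_add; blast)
  then show ?thesis by (simp add: L2g_def ell2_def edge_norm_square)
qed

lemma L2g_edge:
  assumes "L2g a b g"
  shows "sqint (elen a b e) (g j e)" "ell2 (\<lambda>j. edge_norm (elen a b e) (g j e))"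
  using assms by (simp_all add: L2g_iff)

lemma L2g_zero: "L2g a b (\<lambda>_ _ _. 0)"
  by (simp add: L2g_iff sqint_continuous edge_norm_zero ell2_zero)

definition discriminant :: "real \<Rightarrow> real \<Rightarrow> real \<Rightarrow> real \<Rightarrow> complex \<Rightarrow> complex" where
  "discriminant a b \<tau> c \<kappa> =
     of_real c * sn \<kappa> a / 2 + cs \<kappa> a + sn \<kappa> a * (cs \<kappa> b - of_real \<tau>) / sn \<kappa> b"

locale comb =
  fixes a b \<theta> :: real and \<kappa> :: complex
  assumes a_pos: "a > 0" and b_pos: "b > 0"
    and sn_a_nonzero: "sn \<kappa> a \<noteq> 0" and sn_b_nonzero: "sn \<kappa> b \<noteq> 0"
begin

abbreviation \<omega> :: complex where
  "\<omega> \<equiv> exp (\<i> * complex_of_real \<theta>)"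

abbreviation F :: "real \<Rightarrow> complex" where
  "F c \<equiv> discriminant a b (cos \<theta>) c \<kappa>"

lemma \<kappa>_nonzero: "\<kappa> \<noteq> 0"
  using sn_a_nonzero by (auto simp: sn_def)

lemma elen_pos: "elen a b e > 0"
  using a_pos b_pos by (cases e) auto

lemma elen_mem: "0 \<in> {0..elen a b e}" "elen a b e \<in> {0..elen a b e}"
  using elen_pos[of e] by auto

lemma cos_eq_phase: "complex_of_real (cos \<theta>) = (\<omega> + 1 / \<omega>) / 2"
  unfolding cos_of_real[symmetric] cos_exp_eq by (simp add: exp_minus inverse_eq_divide)

definition end_value :: "graph_fun \<Rightarrow> int \<Rightarrow> etype \<Rightarrow> complex" where
  "end_value g j e = edge_sol \<kappa> (g j e) 0 0 (elen a b e)"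

definition end_slope :: "graph_fun \<Rightarrow> int \<Rightarrow> etype \<Rightarrow> complex" where
  "end_slope g j e = edge_slope \<kappa> (g j e) 0 0 (elen a b e)"

text \<open>The two vertical edges at \<open>x\<^sub>j\<close>, traversed upwards from \<open>x\<^sub>j\<close> to \<open>x\<^sub>j\<^sup>+\<close> and, after the
  phase jump, from \<open>x\<^sub>j\<^sup>-\<close> back to \<open>x\<^sub>j\<close>, act as a loop of length \<open>b\<close>.\<close>

definition loop_value :: "graph_fun \<Rightarrow> int \<Rightarrow> complex" where
  "loop_value g j = edge_sol \<kappa> (g j Dn) (end_value g j Up / \<omega>) (end_slope g j Up / \<omega>) (b / 2)"

definition loop_slope :: "graph_fun \<Rightarrow> int \<Rightarrow> complex" where
  "loop_slope g j = edge_slope \<kappa> (g j Dn) (end_value g j Up / \<omega>) (end_slope g j Up / \<omega>) (b / 2)"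

definition hor_slope :: "graph_fun \<Rightarrow> (int \<Rightarrow> complex) \<Rightarrow> int \<Rightarrow> complex" where
  "hor_slope g y j = dirichlet_slope \<kappa> a (y (j - 1)) (y j - end_value g j Hor)"

definition up_slope :: "graph_fun \<Rightarrow> (int \<Rightarrow> complex) \<Rightarrow> int \<Rightarrow> complex" where
  "up_slope g y j = dirichlet_slope \<kappa> b (y j) (\<omega> * (y j - loop_value g j))"

fun start_value :: "graph_fun \<Rightarrow> (int \<Rightarrow> complex) \<Rightarrow> int \<Rightarrow> etype \<Rightarrow> complex" where
  "start_value g y j Hor = y (j - 1)"
| "start_value g y j Up = y j"
| "start_value g y j Dn = edge_sol \<kappa> (g j Up) (y j) (up_slope g y j) (b / 2) / \<omega>"

fun start_slope :: "graph_fun \<Rightarrow> (int \<Rightarrow> complex) \<Rightarrow> int \<Rightarrow> etype \<Rightarrow> complex" where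
  "start_slope g y j Hor = hor_slope g y j"
| "start_slope g y j Up = up_slope g y j"
| "start_slope g y j Dn = edge_slope \<kappa> (g j Up) (y j) (up_slope g y j) (b / 2) / \<omega>"

definition graph_sol :: "graph_fun \<Rightarrow> (int \<Rightarrow> complex) \<Rightarrow> graph_fun" where
  "graph_sol g y j e = edge_sol \<kappa> (g j e) (start_value g y j e) (start_slope g y j e)"

definition vertex_source :: "graph_fun \<Rightarrow> int \<Rightarrow> complex" where
  "vertex_source g j =
     sn \<kappa> a * (end_slope g j Hor + loop_slope g j + (\<omega> - cs \<kappa> b) * loop_value g j / sn \<kappa> b)
     - cs \<kappa> a * end_value g j Hor + end_value g (j + 1) Hor"

lemma end_value_zero [simp]: "end_value (\<lambda>_ _ _. 0) j e = 0"
  and end_slope_zero [simp]: "end_slope (\<lambda>_ _ _. 0) j e = 0"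
  and loop_value_zero [simp]: "loop_value (\<lambda>_ _ _. 0) j = 0"
  and loop_slope_zero [simp]: "loop_slope (\<lambda>_ _ _. 0) j = 0"
  by (simp_all add: end_value_def end_slope_def loop_value_def loop_slope_def
      edge_sol_no_source edge_slope_no_source)

lemma vertex_source_zero: "vertex_source (\<lambda>_ _ _. 0) j = 0"
  by (simp add: vertex_source_def)

lemma graph_sol_cmult:
  "graph_sol (\<lambda>_ _ _. 0) (\<lambda>j. x * y j) j e t = x * graph_sol (\<lambda>_ _ _. 0) y j e t"
  by (cases e) (simp_all add: graph_sol_def hor_slope_def up_slope_def dirichlet_slope_def
      edge_sol_no_source edge_slope_no_source field_simps)

lemma hor_end_value_iff:
  "edge_sol \<kappa> (g j Hor) (y (j - 1)) \<beta> a = y j \<longleftrightarrow> \<beta> = hor_slope g y j"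
  unfolding edge_sol_split[of _ _ _ \<beta>] hor_slope_def dirichlet_slope_iff[OF sn_a_nonzero, symmetric]
  by (auto simp: end_value_def algebra_simps)

lemma loop_end_value_iff:
  "edge_sol \<kappa> (g j Dn) (edge_sol \<kappa> (g j Up) (y j) \<eta> (b / 2) / \<omega>)
      (edge_slope \<kappa> (g j Up) (y j) \<eta> (b / 2) / \<omega>) (b / 2) = y j
    \<longleftrightarrow> \<eta> = up_slope g y j"
proof -
  have "loop_value g j + (y j * cs \<kappa> b + \<eta> * sn \<kappa> b) / \<omega> = y j
    \<longleftrightarrow> y j * cs \<kappa> b + \<eta> * sn \<kappa> b = \<omega> * (y j - loop_value g j)"
    by (auto simp: field_simps)
  then show ?thesis
    unfolding edge_sol_concat[OF \<kappa>_nonzero, of _ "g j Up" _ \<eta>] up_slope_def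
      dirichlet_slope_iff[OF sn_b_nonzero, symmetric]
    by (simp add: loop_value_def end_value_def end_slope_def)
qed

lemma hor_end_slope:
  "edge_slope \<kappa> (g j Hor) (y (j - 1)) (hor_slope g y j) a
    = end_slope g j Hor - dirichlet_slope \<kappa> a (y j - end_value g j Hor) (y (j - 1))"
  using edge_slope_split[of \<kappa> "g j Hor" "y (j - 1)" "hor_slope g y j" a]
    dirichlet_end_slope[OF \<kappa>_nonzero sn_a_nonzero, of "y (j - 1)" "y j - end_value g j Hor"]
  by (simp add: hor_slope_def end_slope_def)

lemma loop_end_slope:
  "edge_slope \<kappa> (g j Dn) (start_value g y j Dn) (start_slope g y j Dn) (b / 2)
    = loop_slope g j - dirichlet_slope \<kappa> b (\<omega> * (y j - loop_value g j)) (y j) / \<omega>"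
  unfolding start_value.simps start_slope.simps
    edge_slope_concat[OF \<kappa>_nonzero, of _ "g j Up" _ "up_slope g y j"]
  using dirichlet_end_slope[OF \<kappa>_nonzero sn_b_nonzero, of "y j" "\<omega> * (y j - loop_value g j)"]
  by (simp add: up_slope_def loop_slope_def end_value_def end_slope_def)

definition vertex_flux :: "graph_fun \<Rightarrow> (int \<Rightarrow> complex) \<Rightarrow> int \<Rightarrow> complex" where
  "vertex_flux g y j =
     - edge_slope \<kappa> (g j Hor) (y (j - 1)) (hor_slope g y j) a + hor_slope g y (j + 1)
     + up_slope g y j - edge_slope \<kappa> (g j Dn) (start_value g y j Dn) (start_slope g y j Dn) (b / 2)"

lemma vertex_flux_eq_jacobi:
  "sn \<kappa> a * (vertex_flux g y j - of_real (c j) * y j)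
    = jacobi (\<lambda>j. F (c j)) y j - vertex_source g j"
  unfolding vertex_flux_def hor_end_slope loop_end_slope
  unfolding hor_slope_def up_slope_def dirichlet_slope_def jacobi_def discriminant_def
    vertex_source_def cos_eq_phase
  using sn_a_nonzero sn_b_nonzero by (simp add: field_simps)

lemma graph_sol_ends [simp]:
  "graph_sol g y j Hor 0 = y (j - 1)" "graph_sol g y j Up 0 = y j"
  "graph_sol g y j Dn 0 = graph_sol g y j Up (b / 2) / \<omega>"
  "graph_sol g y j Hor a = y j" "graph_sol g y j Dn (b / 2) = y j"
  using hor_end_value_iff[of g j y "hor_slope g y j"] loop_end_value_iff[of g j y "up_slope g y j"]
  by (simp_all add: graph_sol_def)

lemma dv_graph_sol:
  assumes "sqint (elen a b e) (g j e)" "t \<in> {0..elen a b e}"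
  shows "dv (elen a b e) (graph_sol g y j e) t
    = edge_slope \<kappa> (g j e) (start_value g y j e) (start_slope g y j e) t"
  unfolding graph_sol_def[abs_def] by (rule dv_edge_sol[OF \<kappa>_nonzero assms elen_pos])

lemma vertex_conds_graph_sol:
  assumes g: "\<And>j e. sqint (elen a b e) (g j e)"
  shows "vertex_conds a b c \<theta> (graph_sol g y) \<longleftrightarrow> jacobi (\<lambda>j. F (c j)) y = vertex_source g"
proof -
  have slope: "dv (elen a b e) (graph_sol g y j e) 0 = start_slope g y j e"
    "dv (elen a b e) (graph_sol g y j e) (elen a b e)
      = edge_slope \<kappa> (g j e) (start_value g y j e) (start_slope g y j e) (elen a b e)" for j e
    using dv_graph_sol[of e g j, OF g] elen_mem[of e] by simp_all
  note slopes = slope(2)[where e = Hor, unfolded elen_simps start_value.simps start_slope.simps]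
    slope(1)[where e = Hor, unfolded elen_simps start_slope.simps]
    slope(1)[where e = Up, unfolded elen_simps start_slope.simps]
    slope(2)[where e = Dn, unfolded elen_simps]
    slope(2)[where e = Up, unfolded elen_simps start_value.simps start_slope.simps]
    slope(1)[where e = Dn, unfolded elen_simps start_slope.simps]
  have "vertex_flux g y j = of_real (c j) * y j \<longleftrightarrow>
      jacobi (\<lambda>j. F (c j)) y j = vertex_source g j" for j
  proof -
    have "vertex_flux g y j = of_real (c j) * y j
        \<longleftrightarrow> sn \<kappa> a * (vertex_flux g y j - of_real (c j) * y j) = 0"
      using sn_a_nonzero by simp
    then show ?thesis unfolding vertex_flux_eq_jacobi by simp
  qed
  then show ?thesis
    unfolding vertex_conds_def slopes fun_eq_iff vertex_flux_def by simp
qed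

lemma vertex_conds_cong:
  assumes "\<And>j e t. t \<in> {0..elen a b e} \<Longrightarrow> \<psi> j e t = \<phi> j e t"
  shows "vertex_conds a b c \<theta> \<psi> \<longleftrightarrow> vertex_conds a b c \<theta> \<phi>"
proof -
  have same_value: "\<psi> j e 0 = \<phi> j e 0" "\<psi> j e (elen a b e) = \<phi> j e (elen a b e)" for j e
    by (rule assms[OF elen_mem(1)], rule assms[OF elen_mem(2)])
  have same_slope: "dv (elen a b e) (\<psi> j e) 0 = dv (elen a b e) (\<phi> j e) 0"
    "dv (elen a b e) (\<psi> j e) (elen a b e) = dv (elen a b e) (\<phi> j e) (elen a b e)" for j e
    using dv_cong[of "elen a b e" "\<psi> j e" "\<phi> j e"] assms elen_mem[of e] by blast+
  note ends = same_value[where e = Hor] same_value[where e = Up] same_value[where e = Dn]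
    same_slope[where e = Hor] same_slope[where e = Up] same_slope[where e = Dn]
  show ?thesis unfolding vertex_conds_def ends[unfolded elen_simps] ..
qed

lemma
  assumes g: "L2g a b g" and \<alpha>: "ell2 \<alpha>" and \<beta>: "ell2 \<beta>"
  shows ell2_edge_sol_end: "ell2 (\<lambda>j. edge_sol \<kappa> (g j e) (\<alpha> j) (\<beta> j) (elen a b e))"
    and ell2_edge_slope_end: "ell2 (\<lambda>j. edge_slope \<kappa> (g j e) (\<alpha> j) (\<beta> j) (elen a b e))"
    and ell2_edge_norm_edge_sol:
      "ell2 (\<lambda>j. edge_norm (elen a b e) (edge_sol \<kappa> (g j e) (\<alpha> j) (\<beta> j)))"
proof -
  let ?l = "elen a b e"
  let ?N = "\<lambda>j. edge_norm ?l (g j e) + cmod (\<alpha> j) + cmod (\<beta> j)"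
  note sqint = L2g_edge(1)[OF g, of e]
  obtain K where K: "\<And>j t. t \<in> {0..?l} \<Longrightarrow>
      cmod (edge_sol \<kappa> (g j e) (\<alpha> j) (\<beta> j) t) \<le> K * ?N j \<and>
      cmod (edge_slope \<kappa> (g j e) (\<alpha> j) (\<beta> j) t) \<le> K * ?N j"
    using edge_sol_bound[OF less_imp_le[OF elen_pos[of e]], of \<kappa>] sqint by metis
  have "ell2 ?N" by (intro ell2_add ell2_norm L2g_edge[OF g] \<alpha> \<beta>)
  note ell2_N = ell2_cmult[OF this, of K] ell2_cmult[OF ell2_cmult[OF this, of K], of "sqrt ?l"]
  show "ell2 (\<lambda>j. edge_sol \<kappa> (g j e) (\<alpha> j) (\<beta> j) ?l)"
    "ell2 (\<lambda>j. edge_slope \<kappa> (g j e) (\<alpha> j) (\<beta> j) ?l)"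
    using K[OF elen_mem(2)] by (auto intro: ell2_comparison[OF ell2_N(1)])
  have "edge_norm ?l (edge_sol \<kappa> (g j e) (\<alpha> j) (\<beta> j)) \<le> sqrt ?l * (K * ?N j)" for j
    using K elen_pos[of e]
    by (intro edge_norm_le sqint_continuous[OF continuous_on_edge_sol[OF \<kappa>_nonzero sqint]]) auto
  then show "ell2 (\<lambda>j. edge_norm ?l (edge_sol \<kappa> (g j e) (\<alpha> j) (\<beta> j)))"
    by (intro ell2_comparison[OF ell2_N(2)]) (simp add: edge_norm_nonneg)
qed

lemma
  assumes g: "L2g a b g"
  shows ell2_end_value: "ell2 (\<lambda>j. end_value g j e)"
    and ell2_end_slope: "ell2 (\<lambda>j. end_slope g j e)"
  unfolding end_value_def end_slope_def
  by (intro ell2_edge_sol_end ell2_edge_slope_end g ell2_zero)+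

lemma
  assumes g: "L2g a b g"
  shows ell2_loop_value: "ell2 (loop_value g)"
    and ell2_loop_slope: "ell2 (loop_slope g)"
  unfolding loop_value_def[abs_def] loop_slope_def[abs_def]
  by (intro ell2_edge_sol_end[where e = Dn, unfolded elen_simps]
      ell2_edge_slope_end[where e = Dn, unfolded elen_simps]
      ell2_divide ell2_end_value ell2_end_slope g)+

lemma ell2_vertex_source: "L2g a b g \<Longrightarrow> ell2 (vertex_source g)"
  unfolding vertex_source_def[abs_def]
  by (intro ell2_intros ell2_shift[of "\<lambda>j. end_value g j Hor"]
      ell2_end_value ell2_end_slope ell2_loop_value ell2_loop_slope)

lemma
  assumes g: "L2g a b g" and y: "ell2 y"
  shows ell2_start_value: "ell2 (\<lambda>j. start_value g y j e)"
    and ell2_start_slope: "ell2 (\<lambda>j. start_slope g y j e)"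
proof -
  have y': "ell2 (\<lambda>j. y (j - 1))" using ell2_shift[OF y, of "- 1"] by simp
  have up_slope: "ell2 (up_slope g y)"
    unfolding up_slope_def[abs_def] dirichlet_slope_def
    by (intro ell2_intros y ell2_loop_value g)
  have hor_slope: "ell2 (hor_slope g y)"
    unfolding hor_slope_def[abs_def] dirichlet_slope_def
    by (intro ell2_intros y y' ell2_end_value g)
  note up_ends = ell2_edge_sol_end[OF g y up_slope, of Up]
    ell2_edge_slope_end[OF g y up_slope, of Up]
  show "ell2 (\<lambda>j. start_value g y j e)" "ell2 (\<lambda>j. start_slope g y j e)"
    using y y' up_slope hor_slope up_ends[THEN ell2_divide] by (cases e; simp)+
qed

lemma L2g_graph_sol:
  assumes g: "L2g a b g" and y: "ell2 y"
  shows "L2g a b (graph_sol g y)"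
  unfolding L2g_iff graph_sol_def[abs_def]
proof (intro conjI allI)
  show "sqint (elen a b e) (edge_sol \<kappa> (g j e) (start_value g y j e) (start_slope g y j e))" for j e
    by (rule sqint_continuous[OF continuous_on_edge_sol[OF \<kappa>_nonzero L2g_edge(1)[OF g]]])
qed (rule ell2_edge_norm_edge_sol[OF g ell2_start_value[OF g y] ell2_start_slope[OF g y]])

lemma solves_graph_sol:
  assumes g: "L2g a b g" and y: "ell2 y" "jacobi (\<lambda>j. F (c j)) y = vertex_source g"
  shows "solves a b c \<theta> (\<kappa>\<^sup>2) (graph_sol g y) g"
  unfolding solves_def
proof (intro conjI allI)
  note sqint = L2g_edge(1)[OF g]
  show "L2g a b (graph_sol g y)" by (rule L2g_graph_sol[OF g y(1)])
  show "vertex_conds a b c \<theta> (graph_sol g y)" using vertex_conds_graph_sol[OF sqint] y(2) by simp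
  show "H2sol (elen a b e) (graph_sol g y j e) (\<lambda>t. - (g j e t + \<kappa>\<^sup>2 * graph_sol g y j e t))"
    for j e
    unfolding graph_sol_def[abs_def] by (rule H2sol_edge_sol[OF \<kappa>_nonzero sqint])
qed

lemma solves_imp_graph_sol:
  assumes g: "L2g a b g" and sol: "solves a b c \<theta> (\<kappa>\<^sup>2) \<psi> g"
  defines "y \<equiv> \<lambda>j. \<psi> j Up 0"
  assumes "t \<in> {0..elen a b e}"
  shows "\<psi> j e t = graph_sol g y j e t"
proof -
  define \<beta> where "\<beta> j e = dv (elen a b e) (\<psi> j e) 0" for j e
  note sqint = L2g_edge(1)[OF g]
  have edge: "\<psi> j e t = edge_sol \<kappa> (g j e) (\<psi> j e 0) (\<beta> j e) t" if "t \<in> {0..elen a b e}" for j e t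
    unfolding \<beta>_def
    by (rule H2sol_eq_edge_sol[OF \<kappa>_nonzero elen_pos sqint _ that])
      (use sol in \<open>simp add: solves_def\<close>)
  have slope: "dv (elen a b e) (\<psi> j e) t = edge_slope \<kappa> (g j e) (\<psi> j e 0) (\<beta> j e) t"
    if "t \<in> {0..elen a b e}" for j e t
    using dv_cong[OF edge that] dv_edge_sol[OF \<kappa>_nonzero sqint that elen_pos] by simp
  note ends = edge[OF elen_mem(2), where e = Hor, unfolded elen_simps]
    edge[OF elen_mem(2), where e = Up, unfolded elen_simps]
    edge[OF elen_mem(2), where e = Dn, unfolded elen_simps]
    slope[OF elen_mem(2), where e = Up, unfolded elen_simps]
  have conds: "\<psi> j Hor a = y j" "\<psi> (j + 1) Hor 0 = y j" "\<psi> j Dn (b / 2) = y j"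
    "\<psi> j Up (b / 2) = \<omega> * \<psi> j Dn 0" "dv (b / 2) (\<psi> j Up) (b / 2) = \<omega> * \<beta> j Dn" for j
    using sol by (auto simp: solves_def vertex_conds_def y_def \<beta>_def)
  have hor: "\<psi> j Hor 0 = y (j - 1)" for j using conds(2)[of "j - 1"] by simp
  have "\<beta> j Hor = hor_slope g y j" for j
    by (rule hor_end_value_iff[THEN iffD1]) (use ends(1)[of j] in \<open>simp add: conds hor\<close>)
  moreover have dn: "\<psi> j Dn 0 = edge_sol \<kappa> (g j Up) (y j) (\<beta> j Up) (b / 2) / \<omega>"
    "\<beta> j Dn = edge_slope \<kappa> (g j Up) (y j) (\<beta> j Up) (b / 2) / \<omega>" for j
    using ends(2,4)[of j] unfolding conds by (simp_all add: y_def field_simps)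
  moreover have "\<beta> j Up = up_slope g y j" for j
    by (rule loop_end_value_iff[THEN iffD1]) (use ends(3)[of j] in \<open>simp add: conds dn\<close>)
  ultimately have "\<psi> j e 0 = start_value g y j e" "\<beta> j e = start_slope g y j e"
    by (cases e; simp add: hor y_def)+
  then show ?thesis using edge[OF assms(4)] by (simp add: graph_sol_def)
qed

lemma solves_imp_jacobi:
  assumes g: "L2g a b g" and sol: "solves a b c \<theta> (\<kappa>\<^sup>2) \<psi> g"
  shows "jacobi (\<lambda>j. F (c j)) (\<lambda>j. \<psi> j Up 0) = vertex_source g"
proof -
  have "vertex_conds a b c \<theta> (graph_sol g (\<lambda>j. \<psi> j Up 0))"
    using vertex_conds_cong[OF solves_imp_graph_sol[OF g sol]] sol by (simp add: solves_def)
  then show ?thesis using vertex_conds_graph_sol[OF L2g_edge(1)[OF g]] by simp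
qed

lemma solves_imp_ell2:
  assumes g: "L2g a b g" and sol: "solves a b c \<theta> (\<kappa>\<^sup>2) \<psi> g"
  shows "ell2 (\<lambda>j. \<psi> j Up 0)"
proof -
  have \<psi>: "L2g a b \<psi>" "\<And>j. \<psi> j Up 0 = \<psi> j Dn (b / 2)"
    "\<And>j e. H2sol (elen a b e) (\<psi> j e) (\<lambda>t. - (g j e t + \<kappa>\<^sup>2 * \<psi> j e t))"
    using sol by (simp_all add: solves_def vertex_conds_def)
  have "b / 2 > 0" using b_pos by simp
  then obtain K where K: "\<And>g u. sqint (b / 2) g \<Longrightarrow> H2sol (b / 2) u (\<lambda>t. - (g t + \<kappa>\<^sup>2 * u t)) \<Longrightarrow>
      cmod (u (b / 2)) \<le> K * (edge_norm (b / 2) u + edge_norm (b / 2) g)"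
    by (rule H2sol_end_value_bound[where E = "\<kappa>\<^sup>2"]) blast
  have bound: "cmod (\<psi> j Up 0) \<le>
      K * (edge_norm (b / 2) (\<psi> j Dn) + edge_norm (b / 2) (g j Dn))" for j
    unfolding \<psi>(2)
    by (rule K[OF L2g_edge(1)[OF g, of Dn, unfolded elen_simps] \<psi>(3)[of Dn, unfolded elen_simps]])
  have "ell2 (\<lambda>j. K * (edge_norm (b / 2) (\<psi> j Dn) + edge_norm (b / 2) (g j Dn)))"
    using L2g_edge(2)[OF \<psi>(1), of Dn] L2g_edge(2)[OF g, of Dn]
    by (intro ell2_cmult ell2_add) simp_all
  then show ?thesis by (rule ell2_comparison[OF _ bound])
qed

end

subsection \<open>The spectrum\<close>

context comb
begin

lemma discriminant_coup: "(\<lambda>j. F (coup \<gamma> \<gamma>t j)) = (\<lambda>_. F \<gamma>)(0 := F \<gamma>t)"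
  by (simp add: fun_eq_iff coup_def)

lemma ex_point_source:
  obtains g where "L2g a b g" "vertex_source g 0 \<noteq> 0" "\<And>j. j \<noteq> 0 \<Longrightarrow> vertex_source g j = 0"
proof -
  have "b / 2 > 0" using b_pos by simp
  from ex_end_slope_source[OF \<kappa>_nonzero this] obtain h where
    h: "sqint (b / 2) h" "edge_sol \<kappa> h 0 0 (b / 2) = 0" "edge_slope \<kappa> h 0 0 (b / 2) \<noteq> 0"
    by blast
  define g :: graph_fun where "g j e = (if j = 0 \<and> e = Dn then h else (\<lambda>_. 0))" for j e
  have ends: "end_value g j Hor = 0" "end_slope g j Hor = 0"
      "end_value g j Up = 0" "end_slope g j Up = 0" for j
    by (simp_all add: g_def end_value_def end_slope_def edge_sol_no_source edge_slope_no_source)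
  have loop: "loop_value g j = 0"
      "loop_slope g j = (if j = 0 then edge_slope \<kappa> h 0 0 (b / 2) else 0)" for j
    using h(2)
    by (simp_all add: loop_value_def loop_slope_def ends g_def
        edge_sol_no_source edge_slope_no_source)
  show thesis
  proof (rule that[of g])
    show "L2g a b g"
      unfolding L2g_iff
    proof (intro conjI allI)
      show "sqint (elen a b e) (g j e)" for j e
        using h(1) by (simp add: g_def sqint_continuous)
      show "ell2 (\<lambda>j. edge_norm (elen a b e) (g j e))" for e
        unfolding ell2_def
        by (rule finite_nonzero_values_imp_summable_on, rule finite_subset[of _ "{0}"])
          (auto simp: g_def edge_norm_zero)
    qed
    show "vertex_source g 0 \<noteq> 0"
      using h(3) sn_a_nonzero by (simp add: vertex_source_def ends loop)
    show "vertex_source g j = 0" if "j \<noteq> 0" for j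
      using that by (simp add: vertex_source_def ends loop)
  qed
qed

lemma
  assumes g: "L2g a b g" "\<And>j. j \<noteq> 0 \<Longrightarrow> vertex_source g j = 0"
    and sol: "solves a b (coup \<gamma> \<gamma>t) \<theta> (\<kappa>\<^sup>2) \<psi> g"
    and z: "z \<noteq> 0" "cmod z \<le> 1" "z + 1 / z = 2 * F \<gamma>"
  shows solves_imp_power_abs: "\<psi> j Up 0 = z ^ nat \<bar>j\<bar> * \<psi> 0 Up 0"
    and solves_imp_defect_eq: "2 * (z - F \<gamma>t) * \<psi> 0 Up 0 = vertex_source g 0"
proof -
  define y where "y j = \<psi> j Up 0" for j
  have jacobi: "jacobi ((\<lambda>_. F \<gamma>)(0 := F \<gamma>t)) y = vertex_source g"
    using solves_imp_jacobi[OF g(1) sol] by (simp add: y_def[abs_def] discriminant_coup)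
  have power: "y j = z ^ nat \<bar>j\<bar> * y 0" for j
    using solves_imp_ell2[OF g(1) sol]
    by (intro jacobi_ell2_unique[OF z, where G = "F \<gamma>t"])
      (simp_all add: y_def[abs_def] jacobi[unfolded y_def[abs_def]] g(2))
  then show "\<psi> j Up 0 = z ^ nat \<bar>j\<bar> * \<psi> 0 Up 0" unfolding y_def .
  show "2 * (z - F \<gamma>t) * \<psi> 0 Up 0 = vertex_source g 0"
    using power[of 1] power[of "-1"] unfolding jacobi[symmetric]
    by (simp add: jacobi_def y_def algebra_simps)
qed

theorem band_in_spectrum:
  assumes "F \<gamma> \<in> band"
  shows "\<kappa>\<^sup>2 \<in> specH a b (coup \<gamma> \<gamma>t) \<theta>"
proof (rule ccontr)
  assume "\<kappa>\<^sup>2 \<notin> specH a b (coup \<gamma> \<gamma>t) \<theta>"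
  moreover obtain g where
    g: "L2g a b g" "vertex_source g 0 \<noteq> 0" "\<And>j. j \<noteq> 0 \<Longrightarrow> vertex_source g j = 0"
    by (rule ex_point_source) blast
  ultimately obtain \<psi> where sol: "solves a b (coup \<gamma> \<gamma>t) \<theta> (\<kappa>\<^sup>2) \<psi> g"
    unfolding specH_def by blast
  obtain z where z: "z \<noteq> 0" "cmod z \<le> 1" "z + 1 / z = 2 * F \<gamma>"
    by (rule ex_joukowski_preimage)
  have "cmod z = 1" using joukowski_unit_circle_iff[OF z(1,3)] assms by simp
  then have "cmod (\<psi> (int n) Up 0) = cmod (\<psi> 0 Up 0)" for n
    using solves_imp_power_abs[OF g(1,3) sol z, of "int n"] by (simp add: norm_mult norm_power)
  moreover have "(\<lambda>n. cmod (\<psi> (int n) Up 0)) \<longlonglongrightarrow> 0"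
    using solves_imp_ell2[OF g(1) sol] by (intro tendsto_norm_zero ell2_tendsto_zero) simp_all
  ultimately have "\<psi> 0 Up 0 = 0" by (simp add: LIMSEQ_const_iff)
  then show False using solves_imp_defect_eq[OF g(1,3) sol z] g(2) by simp
qed

definition bound_state :: "complex \<Rightarrow> graph_fun" where
  "bound_state z = graph_sol (\<lambda>_ _ _. 0) (\<lambda>j. z ^ nat \<bar>j\<bar>)"

lemma bound_state_nonzero: "\<not> zero_on_edges a b (bound_state z)"
proof -
  have "bound_state z 0 Up 0 = 1" by (simp add: bound_state_def)
  with elen_mem(1)[of Up] show ?thesis unfolding zero_on_edges_def by (metis zero_neq_one)
qed

context
  fixes \<gamma> \<gamma>t :: real and z :: complex
  assumes z: "z \<noteq> 0" "cmod z < 1" "z + 1 / z = 2 * F \<gamma>"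
begin

lemma bound_state_in_eigsp:
  assumes "F \<gamma>t = z"
  shows "bound_state z \<in> eigsp a b (coup \<gamma> \<gamma>t) \<theta> (\<kappa>\<^sup>2)"
  unfolding bound_state_def eigsp_def mem_Collect_eq
proof (rule solves_graph_sol[OF L2g_zero ell2_power_abs[OF z(2)]])
  show "jacobi (\<lambda>j. F (coup \<gamma> \<gamma>t j)) (\<lambda>j. z ^ nat \<bar>j\<bar>) = vertex_source (\<lambda>_ _ _. 0)"
    unfolding discriminant_coup jacobi_power_abs[OF z(1,3), abs_def] vertex_source_zero[abs_def]
    using assms by auto
qed

lemma
  assumes "\<psi> \<in> eigsp a b (coup \<gamma> \<gamma>t) \<theta> (\<kappa>\<^sup>2)"
  shows eigsp_eq_bound_state:
      "t \<in> {0..elen a b e} \<Longrightarrow> \<psi> j e t = \<psi> 0 Up 0 * bound_state z j e t"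
    and eigsp_vertex_zero: "F \<gamma>t \<noteq> z \<Longrightarrow> \<psi> 0 Up 0 = 0"
proof -
  have sol: "solves a b (coup \<gamma> \<gamma>t) \<theta> (\<kappa>\<^sup>2) \<psi> (\<lambda>_ _ _. 0)" using assms by (simp add: eigsp_def)
  have "cmod z \<le> 1" using z(2) by simp
  note power = solves_imp_power_abs[OF L2g_zero vertex_source_zero sol z(1) this z(3)]
    and defect = solves_imp_defect_eq[OF L2g_zero vertex_source_zero sol z(1) this z(3)]
  have "(\<lambda>j. \<psi> j Up 0) = (\<lambda>j. \<psi> 0 Up 0 * z ^ nat \<bar>j\<bar>)"
    using power by (subst mult.commute) (rule ext)
  then show "\<psi> j e t = \<psi> 0 Up 0 * bound_state z j e t" if "t \<in> {0..elen a b e}"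
    using solves_imp_graph_sol[OF L2g_zero sol that] by (simp only: graph_sol_cmult bound_state_def)
  show "\<psi> 0 Up 0 = 0" if "F \<gamma>t \<noteq> z" using defect that by (simp add: vertex_source_zero)
qed

theorem specH_iff: "\<kappa>\<^sup>2 \<in> specH a b (coup \<gamma> \<gamma>t) \<theta> \<longleftrightarrow> F \<gamma>t = z"
proof
  assume "F \<gamma>t = z"
  from bound_state_in_eigsp[OF this] bound_state_nonzero
  show "\<kappa>\<^sup>2 \<in> specH a b (coup \<gamma> \<gamma>t) \<theta>" unfolding specH_def eigsp_def by blast
next
  assume spec: "\<kappa>\<^sup>2 \<in> specH a b (coup \<gamma> \<gamma>t) \<theta>"
  show "F \<gamma>t = z"
  proof (rule ccontr)
    assume "F \<gamma>t \<noteq> z"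
    have "\<exists>\<psi>. solves a b (coup \<gamma> \<gamma>t) \<theta> (\<kappa>\<^sup>2) \<psi> g" if g: "L2g a b g" for g
    proof -
      obtain y where "ell2 y" "jacobi ((\<lambda>_. F \<gamma>)(0 := F \<gamma>t)) y = vertex_source g"
        using jacobi_solvable[OF z \<open>F \<gamma>t \<noteq> z\<close> ell2_vertex_source[OF g]] by blast
      then show ?thesis using solves_graph_sol[OF g] by (metis discriminant_coup)
    qed
    moreover have "zero_on_edges a b \<psi>" if "solves a b (coup \<gamma> \<gamma>t) \<theta> (\<kappa>\<^sup>2) \<psi> (\<lambda>_ _ _. 0)" for \<psi>
      using eigsp_eq_bound_state[of \<psi>] eigsp_vertex_zero[OF _ \<open>F \<gamma>t \<noteq> z\<close>, of \<psi>] that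
      by (simp add: eigsp_def zero_on_edges_def)
    ultimately show False using spec unfolding specH_def by blast
  qed
qed

end

end

subsection \<open>Isolation of the eigenvalue\<close>

lemma sn_eq_0_iff: "sn \<kappa> t = 0 \<longleftrightarrow> sin (\<kappa> * of_real t) = 0"
  by (auto simp: sn_def)

lemma open_sn_nonzero: "open {\<kappa>. sn \<kappa> b \<noteq> 0}"
  unfolding sn_eq_0_iff by (intro open_Collect_neq continuous_intros)

lemma connected_sn_nonzero:
  assumes "b \<noteq> 0"
  shows "connected {\<kappa>. sn \<kappa> b \<noteq> 0}"
proof -
  have "{\<kappa>::complex. sin (\<kappa> * of_real b) = 0}
      \<subseteq> range (\<lambda>n::int. complex_of_real (n * pi) / of_real b)"
    using assms by (auto simp: sin_eq_0 field_simps)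
  then have "countable {\<kappa>::complex. sin (\<kappa> * of_real b) = 0}"
    by (rule countable_subset) simp
  from connected_open_diff_countable[OF _ open_UNIV connected_UNIV this]
  show ?thesis by (simp add: sn_eq_0_iff Compl_eq_Diff_UNIV[symmetric] Collect_neg_eq)
qed

lemma holomorphic_on_discriminant:
  "discriminant a b \<tau> c holomorphic_on {\<kappa>. sn \<kappa> b \<noteq> 0}"
proof -
  have "sn \<kappa> b \<noteq> 0 \<Longrightarrow> \<kappa> \<noteq> 0" for \<kappa> by (auto simp: sn_def)
  then show ?thesis
    unfolding discriminant_def[abs_def] cs_def sn_def by (intro holomorphic_intros) auto
qed

text \<open>With \<open>F\<close>, \<open>G\<close> the two discriminants and \<open>z + 1/z = 2 F\<close>, this is \<open>(G - z) (G - 1/z)\<close>.\<close>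

definition resonance :: "real \<Rightarrow> real \<Rightarrow> real \<Rightarrow> real \<Rightarrow> real \<Rightarrow> complex \<Rightarrow> complex" where
  "resonance a b \<tau> \<gamma> \<gamma>t \<kappa> =
     (discriminant a b \<tau> \<gamma>t \<kappa>)\<^sup>2 - 2 * discriminant a b \<tau> \<gamma> \<kappa> * discriminant a b \<tau> \<gamma>t \<kappa> + 1"

lemma resonance_eq_0:
  assumes "z \<noteq> 0" "z + 1 / z = 2 * discriminant a b \<tau> \<gamma> \<kappa>" "discriminant a b \<tau> \<gamma>t \<kappa> = z"
  shows "resonance a b \<tau> \<gamma> \<gamma>t \<kappa> = 0"
  using assms(1) unfolding resonance_def assms(2)[symmetric] assms(3)
  by (simp add: field_simps power2_eq_square)

lemma cs_imaginary: "cs (\<i> * of_real t) l = of_real (cosh (t * l))"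
  and sn_imaginary: "sn (\<i> * of_real t) l = of_real (sinh (t * l) / t)"
proof -
  have "cos (\<i> * complex_of_real x) = of_real (cosh x)"
    and "sin (\<i> * complex_of_real x) = \<i> * of_real (sinh x)" for x
    by (simp_all add: cos_exp_eq sin_exp_eq cosh_field_def sinh_field_def exp_minus
        scaleR_conv_of_real exp_of_real[symmetric] field_simps)
  from this[of "t * l"] show "cs (\<i> * of_real t) l = of_real (cosh (t * l))"
    and "sn (\<i> * of_real t) l = of_real (sinh (t * l) / t)"
    by (simp_all add: cs_def sn_def mult.assoc)
qed

lemma discriminant_imaginary:
  assumes "t > 0"
  shows "discriminant a b \<tau> c (\<i> * of_real t)
    = of_real (c * sinh (t * a) / (2 * t) + cosh (t * a)
        + sinh (t * a) * (cosh (t * b) - \<tau>) / sinh (t * b))"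
  using assms unfolding discriminant_def cs_imaginary sn_imaginary by simp

lemma tanh_scaled_at_top: "((\<lambda>t. tanh (t * l)) \<longlongrightarrow> 1) at_top"
  and inverse_sinh_scaled_at_top: "((\<lambda>t. inverse (sinh (t * l))) \<longlongrightarrow> 0) at_top"
  if "l > 0" for l :: real
proof -
  have scale: "filterlim (\<lambda>t. t * l) at_top at_top"
    using that
    by (intro filterlim_at_top_mult_tendsto_pos[OF tendsto_const]) (simp_all add: filterlim_ident)
  show "((\<lambda>t. tanh (t * l)) \<longlongrightarrow> 1) at_top"
    by (rule filterlim_compose[OF tanh_real_at_top scale])
  show "((\<lambda>t. inverse (sinh (t * l))) \<longlongrightarrow> 0) at_top"
    by (rule tendsto_inverse_0_at_top[OF filterlim_compose[OF sinh_real_at_top scale]])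
qed

lemma discriminant_imaginary_asymptotics:
  assumes "a > 0" "b > 0"
  shows "((\<lambda>t. discriminant a b \<tau> c (\<i> * of_real t) / of_real (sinh (t * a))) \<longlongrightarrow> 2) at_top"
proof -
  define R where "R t = c / 2 * inverse t + inverse (tanh (t * a))
      + (inverse (tanh (t * b)) - \<tau> * inverse (sinh (t * b)))" for t
  have "(R \<longlongrightarrow> c / 2 * 0 + inverse 1 + (inverse 1 - \<tau> * 0)) at_top"
    unfolding R_def[abs_def]
    by (intro tendsto_intros tanh_scaled_at_top inverse_sinh_scaled_at_top assms
        tendsto_inverse_0_at_top filterlim_ident) simp_all
  then have "((\<lambda>t. complex_of_real (R t)) \<longlongrightarrow> of_real 2) at_top"
    by (intro tendsto_of_real) simp
  moreover have "\<forall>\<^sub>F t in at_top.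
      complex_of_real (R t) = discriminant a b \<tau> c (\<i> * of_real t) / of_real (sinh (t * a))"
    using eventually_gt_at_top[of 0]
  proof eventually_elim
    case (elim t)
    then have "sinh (t * a) \<noteq> 0" "sinh (t * b) \<noteq> 0" using assms by simp_all
    with elim show ?case
      unfolding discriminant_imaginary[OF elim] of_real_divide[symmetric] of_real_eq_iff
      by (simp add: R_def tanh_def field_simps)
  qed
  ultimately show ?thesis by (simp add: tendsto_cong)
qed

lemma resonance_nonzero:
  assumes "a > 0" "b > 0"
  obtains \<kappa> where "sn \<kappa> b \<noteq> 0" "resonance a b \<tau> \<gamma> \<gamma>t \<kappa> \<noteq> 0"
proof -
  define s where "s t = complex_of_real (sinh (t * a))" for t
  define D where "D c t = discriminant a b \<tau> c (\<i> * of_real t) / s t" for c t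
  have tendsto_D: "(D c \<longlongrightarrow> 2) at_top" for c
    unfolding D_def[abs_def] s_def by (rule discriminant_imaginary_asymptotics[OF assms])
  have tendsto_inverse_s: "((\<lambda>t. 1 / s t) \<longlongrightarrow> of_real 0) at_top"
    using tendsto_of_real[OF inverse_sinh_scaled_at_top[OF assms(1)], where 'a = complex]
    by (simp add: s_def inverse_eq_divide)
  have "((\<lambda>t. (D \<gamma>t t)\<^sup>2 - 2 * D \<gamma> t * D \<gamma>t t + (1 / s t)\<^sup>2)
      \<longlongrightarrow> 2\<^sup>2 - 2 * 2 * 2 + (of_real 0)\<^sup>2) at_top"
    by (intro tendsto_intros tendsto_D tendsto_inverse_s)
  moreover have "resonance a b \<tau> \<gamma> \<gamma>t (\<i> * of_real t) / (s t)\<^sup>2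
      = (D \<gamma>t t)\<^sup>2 - 2 * D \<gamma> t * D \<gamma>t t + (1 / s t)\<^sup>2" for t
    by (simp add: resonance_def D_def power_divide power2_eq_square
        add_divide_distrib diff_divide_distrib)
  ultimately have "((\<lambda>t. resonance a b \<tau> \<gamma> \<gamma>t (\<i> * of_real t) / (s t)\<^sup>2) \<longlongrightarrow> - 4) at_top"
    by simp
  then have "\<forall>\<^sub>F t in at_top. resonance a b \<tau> \<gamma> \<gamma>t (\<i> * of_real t) / (s t)\<^sup>2 \<noteq> 0"
    by (rule tendsto_imp_eventually_ne) simp
  with eventually_gt_at_top[of 0]
  have "\<forall>\<^sub>F t in at_top. sn (\<i> * of_real t) b \<noteq> 0 \<and> resonance a b \<tau> \<gamma> \<gamma>t (\<i> * of_real t) \<noteq> 0"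
  proof eventually_elim
    case (elim t)
    then show ?case using assms by (auto simp: sn_imaginary)
  qed
  from eventually_happens[OF this] show thesis using that by auto
qed

lemma eventually_resonance_nonzero:
  assumes "a > 0" "b > 0" "sn \<kappa> b \<noteq> 0"
  shows "\<forall>\<^sub>F w in at \<kappa>. resonance a b \<tau> \<gamma> \<gamma>t w \<noteq> 0"
proof -
  obtain \<beta> where \<beta>: "\<beta> \<in> {\<kappa>. sn \<kappa> b \<noteq> 0}" "resonance a b \<tau> \<gamma> \<gamma>t \<beta> \<noteq> 0"
    using resonance_nonzero[OF assms(1,2)] by blast
  have "resonance a b \<tau> \<gamma> \<gamma>t holomorphic_on {\<kappa>. sn \<kappa> b \<noteq> 0}"
    unfolding resonance_def[abs_def] by (intro holomorphic_intros holomorphic_on_discriminant)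
  from non_zero_neighbour_alt[OF this open_sn_nonzero connected_sn_nonzero _ \<beta>, of \<kappa>] assms
  show ?thesis by (simp add: eventually_conj_iff)
qed

lemma eventually_at_square:
  fixes \<kappa> :: complex
  assumes "\<kappa> \<noteq> 0" "\<forall>\<^sub>F w in at \<kappa>. P (w\<^sup>2)"
  shows "\<forall>\<^sub>F \<mu> in at (\<kappa>\<^sup>2). P \<mu>"
proof -
  define r where "r \<mu> = \<kappa> * csqrt (\<mu> / \<kappa>\<^sup>2)" for \<mu>
  have r_square: "(r \<mu>)\<^sup>2 = \<mu>" for \<mu> using assms(1) by (simp add: r_def power_mult_distrib)
  have "filterlim r (at \<kappa>) (at (\<kappa>\<^sup>2))"
  proof (rule filterlim_atI)
    have "isCont csqrt (\<kappa>\<^sup>2 / \<kappa>\<^sup>2)"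
      using assms(1) by (intro continuous_at_csqrt) (simp add: complex_nonpos_Reals_iff)
    then have "(r \<longlongrightarrow> \<kappa> * csqrt (\<kappa>\<^sup>2 / \<kappa>\<^sup>2)) (at (\<kappa>\<^sup>2))"
      unfolding r_def[abs_def] by (intro tendsto_intros isCont_tendsto_compose[where g = csqrt])
        (use assms(1) in auto)
    then show "(r \<longlongrightarrow> \<kappa>) (at (\<kappa>\<^sup>2))" using assms(1) by simp
    show "\<forall>\<^sub>F \<mu> in at (\<kappa>\<^sup>2). r \<mu> \<noteq> \<kappa>"
      unfolding eventually_at_filter by (rule always_eventually) (metis r_square)
  qed
  from eventually_compose_filterlim[OF assms(2) this] show ?thesis by (simp add: r_square)
qed

lemma (in comb) eventually_in_resolvent_set:
  assumes "F \<gamma> \<notin> band"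
  shows "\<forall>\<^sub>F \<mu> in at (\<kappa>\<^sup>2). \<mu> \<notin> specH a b (coup \<gamma> \<gamma>t) \<theta>"
proof (rule eventually_at_square[OF \<kappa>_nonzero])
  have "\<forall>\<^sub>F w in at \<kappa>. w \<in> {w. sn w a \<noteq> 0}" "\<forall>\<^sub>F w in at \<kappa>. w \<in> {w. sn w b \<noteq> 0}"
    using sn_a_nonzero sn_b_nonzero by (intro eventually_at_in_open' open_sn_nonzero; simp)+
  moreover have "\<forall>\<^sub>F w in at \<kappa>. discriminant a b (cos \<theta>) \<gamma> w \<in> - band"
  proof (rule topological_tendstoD)
    have "isCont (discriminant a b (cos \<theta>) \<gamma>) \<kappa>"
      using holomorphic_on_imp_continuous_on[OF holomorphic_on_discriminant]
        open_sn_nonzero sn_b_nonzero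
      by (simp add: continuous_on_eq_continuous_at)
    then show "(discriminant a b (cos \<theta>) \<gamma> \<longlongrightarrow> F \<gamma>) (at \<kappa>)" by (simp add: isCont_def)
    show "open (- band)" using closed_band by (rule open_Compl)
  qed (use assms in simp)
  moreover have "\<forall>\<^sub>F w in at \<kappa>. resonance a b (cos \<theta>) \<gamma> \<gamma>t w \<noteq> 0"
    by (rule eventually_resonance_nonzero[OF a_pos b_pos sn_b_nonzero])
  ultimately show "\<forall>\<^sub>F w in at \<kappa>. w\<^sup>2 \<notin> specH a b (coup \<gamma> \<gamma>t) \<theta>"
  proof eventually_elim
    case (elim w)
    then interpret near: comb a b \<theta> w by unfold_locales (use a_pos b_pos in auto)
    obtain z where z: "z \<noteq> 0" "cmod z \<le> 1" "z + 1 / z = 2 * near.F \<gamma>"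
      by (rule ex_joukowski_preimage)
    then have "cmod z < 1" using joukowski_unit_circle_iff[OF z(1,3)] elim by auto
    then show ?case
      using near.specH_iff[OF z(1) _ z(3), of \<gamma>t] resonance_eq_0[OF z(1,3), of \<gamma>t] elim by auto
  qed
qed

theorem (in comb) disc_specH_iff:
  assumes z: "z \<noteq> 0" "cmod z < 1" "z + 1 / z = 2 * F \<gamma>"
  shows "\<kappa>\<^sup>2 \<in> disc_specH a b (coup \<gamma> \<gamma>t) \<theta> \<longleftrightarrow> F \<gamma>t = z"
proof
  assume "\<kappa>\<^sup>2 \<in> disc_specH a b (coup \<gamma> \<gamma>t) \<theta>"
  then show "F \<gamma>t = z" using specH_iff[OF z] unfolding disc_specH_def by blast
next
  assume "F \<gamma>t = z"
  let ?H = "coup \<gamma> \<gamma>t"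
  have "F \<gamma> \<notin> band"
    using joukowski_unit_circle_iff[OF z(1,3)] z(2) by auto
  from eventually_in_resolvent_set[OF this]
  have isolated: "\<exists>\<epsilon>>0. \<forall>\<mu>. \<mu> \<noteq> \<kappa>\<^sup>2 \<and> cmod (\<mu> - \<kappa>\<^sup>2) < \<epsilon> \<longrightarrow> \<mu> \<notin> specH a b ?H \<theta>"
    unfolding eventually_at dist_norm by blast
  note eigen = bound_state_in_eigsp[OF z \<open>F \<gamma>t = z\<close>]
  have "\<exists>co. \<forall>j e. \<forall>t\<in>{0..elen a b e}. \<psi> j e t = (\<Sum>\<phi>\<in>{bound_state z}. co \<phi> * \<phi> j e t)"
    if "\<psi> \<in> eigsp a b ?H \<theta> (\<kappa>\<^sup>2)" for \<psi>
    using eigsp_eq_bound_state[OF z that] by (intro exI[of _ "\<lambda>_. \<psi> 0 Up 0"]) simp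
  then have "\<exists>B. finite B \<and> B \<subseteq> eigsp a b ?H \<theta> (\<kappa>\<^sup>2) \<and> (\<forall>\<psi>\<in>eigsp a b ?H \<theta> (\<kappa>\<^sup>2).
      \<exists>co. \<forall>j e. \<forall>t\<in>{0..elen a b e}. \<psi> j e t = (\<Sum>\<phi>\<in>B. co \<phi> * \<phi> j e t))"
    using eigen by (intro exI[of _ "{bound_state z}"]) simp
  moreover have "\<kappa>\<^sup>2 \<in> specH a b ?H \<theta>" using specH_iff[OF z] \<open>F \<gamma>t = z\<close> by simp
  moreover have "\<exists>\<psi>\<in>eigsp a b ?H \<theta> (\<kappa>\<^sup>2). \<not> zero_on_edges a b \<psi>"
    using eigen bound_state_nonzero by blast
  ultimately show "\<kappa>\<^sup>2 \<in> disc_specH a b ?H \<theta>"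
    using isolated unfolding disc_specH_def by blast
qed

lemma discriminant_of_real:
  assumes "sin (k * b) \<noteq> 0"
  shows "discriminant a b \<tau> c (of_real k) = of_real (ff a b c \<tau> k)"
proof -
  have "ff a b c \<tau> k = c * sin (k * a) / (2 * k) + cos (k * a)
      + sin (k * a) * (cos (k * b) - \<tau>) / sin (k * b)"
    using assms by (simp add: ff_def distrib_left sin_add field_simps)
  moreover have "k \<noteq> 0" using assms by auto
  ultimately show ?thesis
    unfolding discriminant_def cs_def sn_def of_real_mult[symmetric] sin_of_real cos_of_real by simp
qed

lemma joukowski_real_preimage:
  fixes f :: real
  assumes "\<bar>f\<bar> > 1"
  defines "z \<equiv> if f < -1 then f + sqrt (f\<^sup>2 - 1) else f - sqrt (f\<^sup>2 - 1)"
  shows "z \<noteq> 0" "\<bar>z\<bar> < 1" "z + 1 / z = 2 * f"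
proof -
  define s where "s = sqrt (f\<^sup>2 - 1)"
  have "f\<^sup>2 > 1" using assms(1) one_less_power[of "\<bar>f\<bar>" 2] by simp
  then have s: "s > 0" "s\<^sup>2 = f\<^sup>2 - 1" by (simp_all add: s_def)
  have product: "z * (2 * f - z) = 1"
    using s(2) unfolding z_def s_def[symmetric] by (auto simp: algebra_simps power2_eq_square)
  then show "z \<noteq> 0" by auto
  with product show "z + 1 / z = 2 * f" by (simp add: field_simps)
  have "1 < \<bar>2 * f - z\<bar>" using s(1) assms(1) by (auto simp: z_def s_def[symmetric])
  with \<open>z \<noteq> 0\<close> have "\<bar>z\<bar> * 1 < \<bar>z\<bar> * \<bar>2 * f - z\<bar>" by (intro mult_strict_left_mono) auto
  also have "\<dots> = 1" by (simp add: product flip: abs_mult)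
  finally show "\<bar>z\<bar> < 1" by simp
qed

theorem theorem3p2:
  fixes a b \<gamma> \<gamma>t \<theta> E k \<tau> :: real
  assumes "a > 0" and "b > 0"
    and "\<theta> \<in> {-pi..pi}"
    and "\<tau> = cos \<theta>"
    and "E > 0"
    and "complex_of_real E \<notin> specHg a b \<gamma> \<gamma> \<theta>"
    and "k = sqrt E"
    and "k \<notin> Xi a b"
  shows "complex_of_real E \<in> disc_specHg a b \<gamma> \<gamma>t \<theta> \<longleftrightarrow>
    (ff a b \<gamma>t \<tau> k =
      (if ff a b \<gamma> \<tau> k < -1 then ff a b \<gamma> \<tau> k + sqrt ((ff a b \<gamma> \<tau> k)^2 - 1)
       else ff a b \<gamma> \<tau> k - sqrt ((ff a b \<gamma> \<tau> k)^2 - 1)))"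
    (is "_ \<longleftrightarrow> _ = ?z")
proof -
  have k: "k > 0" "sin (k * a) \<noteq> 0" "sin (k * b) \<noteq> 0"
    using assms(5,7,8) by (auto simp: Xi_def)
  interpret comb a b \<theta> "complex_of_real k"
    by unfold_locales
      (use assms(1,2) k in \<open>auto simp: sn_eq_0_iff sin_of_real simp flip: of_real_mult\<close>)
  have E_eq: "complex_of_real E = (complex_of_real k)\<^sup>2"
    using assms(5,7) by (simp flip: of_real_power)
  have F_eq: "F c = of_real (ff a b c \<tau> k)" for c
    unfolding assms(4) by (rule discriminant_of_real[OF k(3)])
  have "\<not> \<bar>ff a b \<gamma> \<tau> k\<bar> \<le> 1"
    using band_in_spectrum[of \<gamma> \<gamma>] assms(6)
    unfolding specHg_def E_eq F_eq of_real_in_band_iff by blast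
  then have "\<bar>ff a b \<gamma> \<tau> k\<bar> > 1" by simp
  note z = joukowski_real_preimage[OF this]
  have "complex_of_real ?z \<noteq> 0" "cmod (of_real ?z) < 1"
    using z(1,2) by (simp_all only: of_real_eq_0_iff norm_of_real not_False_eq_True)
  moreover have "of_real ?z + 1 / of_real ?z = 2 * F \<gamma>"
    using arg_cong[OF z(3), of complex_of_real] unfolding F_eq by simp
  ultimately show ?thesis
    using disc_specH_iff[of ?z \<gamma> \<gamma>t] unfolding disc_specHg_def E_eq F_eq of_real_eq_iff by blast
qed

end
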